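(* Let $\mathcal{G}$ be a minor-closed class of coloured ribbon graphs (closed under deletion and contraction of edges). Then there is a unique map $U:\mathcal{G}\to\mathbb{Z}[\alpha,\beta,\gamma,a_{\mathrm{bs}},a_{\mathrm{bp}}^{1/2},a_{\mathrm{olc}},a_{\mathrm{olh}}^{1/2},b_{\mathrm{bs}},b_{\mathrm{bp}}^{1/2},b_{\mathrm{olc}},b_{\mathrm{olh}}^{1/2}]$ such that $U(\mathbb{G})=a_iU(\mathbb{G}\backslash e)+b_jU(\mathbb{G}/e)$ whenever $e$ is an edge of $\mathbb{G}$ of type $(i,j)$, and $U(\mathbb{G})=\alpha^n\beta^m\gamma^v$ whenever $\mathbb{G}$ is edgeless with $v$ vertices, $n$ vertex colour classes and $m$ boundary colour classes, where $a_{\mathrm{nl}}=a_{\mathrm{bp}}^{1/2}a_{\mathrm{olh}}^{1/2}$ and $b_{\mathrm{nl}}=b_{\mathrm{bp}}^{1/2}b_{\mathrm{olh}}^{1/2}$. Moreover, $$U(\mathbb{G})=\alpha^{k(\mathbb{G}/\mathcal{V})}\beta^{k(\mathbb{G}^*/\mathcal{B})}\gamma^{v(\mathbb{G})-\rho(\mathbb{G})}b_{\mathrm{bs}}^{r_1(\mathbb{G})}b_{\mathrm{bp}}^{r_2(\mathbb{G})}a_{\mathrm{olc}}^{r_3(\mathbb{G})}a_{\mathrm{olh}}^{r_4(\mathbb{G})}\,T_{ps}\Big(\mathbb{G};\frac{\alpha\gamma a_{\mathrm{bs}}}{b_{\mathrm{bs}}},\frac{\gamma a_{\mathrm{bp}}}{b_{\mathrm{bp}}},\frac{\beta\gamma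 b_{\mathrm{olc}}}{a_{\mathrm{olc}}},\frac{\gamma b_{\mathrm{olh}}}{a_{\mathrm{olh}}}\Big).$$
   Context: A ribbon graph $\mathbb{G}=(V,E)$ is a surface with boundary represented as a union of two finite sets of closed discs, vertices and edges, meeting in disjoint line segments, each on the boundary of exactly one vertex and one edge, each edge containing exactly two such segments; $F(\mathbb{G})$ is its set of boundary components. A loop is an edge meeting one vertex; non-orientable if its union with its vertex is a Möbius band, orientable otherwise. Deletion $\mathbb{G}\backslash e$ removes $e$; contraction $\mathbb{G}/e$ glues a disc (new vertex) along each boundary component of $e\cup u\cup v$ ($u,v$ the ends of $e$) and removes $e,u,v$ (non-loop: ends merge; non-orientable loop: one new vertex; orientable loop: two new vertices; boundary components unchanged). $e^c=E\setminus\{e\}$. A coloured ribbon graph has a partition $\mathcal{V}$ of $V$ into vertex colour classes and a partition $\mathcal{B}$ of $F(\mathbb{G})$ into boundary colour classes. Contraction of $e$: boundary classes unchanged; if distinct ends $u,v$ merge into $p$, the classes of $u,v$ merge into one class containing $p$; if $e$ is a non-orientable loop at $u$ producing $p$, $p$ replaces $u$; if $e$ is an orientable loop at $u$ producing $p,q$, both replace $u$ in its class. Deletion of $e$: vertex classes unchanged; if $e$ meets distinct boundary components $a,b$ merging into $r$, their classes merge into one class containing $r$; if $e$ meets one boundary component $a$, the resulting one or two components replace $a$ in its class. Other elements keep their classes. Edge types: $\mathrm{bs}$ = one edge joining two distinct vertices in different vertex colour classes; $\mathrm{bp}$ = one edge joining two distinct vertices in the same vertex colour class; $\mathrm{olc}$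 = one vertex with an orientable loop whose two boundary components are in different boundary colour classes; $\mathrm{olh}$ = same but in the same class; $\mathrm{nl}$ = one vertex with a non-orientable loop. Edge $e$ has type $(i,j)$ if after removing isolated vertices $\mathbb{G}/e^c=i$ and $\mathbb{G}\backslash e^c=j$. Parameters: $v(\mathbb{G})=|V|$; for a graph $H$, $r_H(A)$ is the rank (vertices minus components) of the spanning subgraph with edges $A$ and $k(H)$ is its number of components. $b(A)$ = number of boundary components of ribbon subgraph $(V,A)$; $\rho(A)=\frac12(|A|+|V|-b(A))$, $\rho(\mathbb{G})=\rho(E)$. $\mathbb{G}/\mathcal{V}$: graph on vertex colour classes with an edge for each edge of $\mathbb{G}$ joining the classes of its ends. $\mathbb{G}^*/\mathcal{B}$: graph on boundary colour classes with an edge for each edge $e$ joining the classes of the boundary components touching $e$. $r_1(A)=r_{\mathbb{G}/\mathcal{V}}(A)$, $r_2(A)=\rho(A)-r_{\mathbb{G}/\mathcal{V}}(A)$, $r_3(A)=r_{\mathbb{G}^*/\mathcal{B}}(E)-r_{\mathbb{G}^*/\mathcal{B}}(E\setminus A)$, $r_4(A)=|A|+r_{\mathbb{G}^*/\mathcal{B}}(E\setminus A)-r_{\mathbb{G}^*/\mathcal{B}}(E)-\rho(A)$, $r_i(\mathbb{G})=r_i(E)$. The Tutte polynomial of a coloured ribbon graph is $T_{ps}(\mathbb{G};w,x,y,z)=\sum_{A\subseteq E}w^{r_1(E)-r_1(A)}x^{r_2(E)-r_2(A)}y^{r_3(A)}z^{r_4(A)}\in\mathbb{Z}[w,x^{1/2},y,z^{1/2}]$.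 *)

theory Defs
  imports
    Complex_Main
    "HOL-Library.FuncSet"
    "HOL-Library.Disjoint_Sets"
    "HOL-Library.Poly_Mapping"
    "HOL-Computational_Algebra.Fraction_Field"
begin

section \<open>Ribbon graphs\<close>

text \<open>
  Finitely many points cut the boundary circles of the vertex discs into arcs, which along each
  circle are alternately of two kinds: \<open>free_arc\<close> and \<open>line_seg\<close> map a point to the other
  endpoint of the arc of the first, respectively second, kind at that point.  An edge disc may be
  glued to a vertex disc only along an arc of the second kind (a line segment).  An edge disc meets
  the vertex discs in exactly two line segments; it is given by the set of the four endpoints of
  these, and its boundary circle alternates between its two line segments and its two free sides,
  \<open>edge_side\<close> giving the other endpoint of such a side.

  Line segments that carry no edge are allowed; they are ordinary pieces of the boundary of the
  surface.  So an isolated vertex is a circle none of whose line segments carries an edge, and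
  deleting an edge leaves the vertex discs literally unchanged.
\<close>

record 'p ribbon =
  points :: "'p set"
  free_arc :: "'p \<Rightarrow> 'p"
  line_seg :: "'p \<Rightarrow> 'p"
  edge_side :: "'p \<Rightarrow> 'p"
  edges :: "'p set set"

definition fpf_involution_on :: "'p set \<Rightarrow> ('p \<Rightarrow> 'p) \<Rightarrow> bool" where
  "fpf_involution_on S f \<longleftrightarrow> (\<forall>p\<in>S. f p \<in> S \<and> f p \<noteq> p \<and> f (f p) = p)"

definition ribbon_graph :: "('p, 'm) ribbon_scheme \<Rightarrow> bool" where
  "ribbon_graph G \<longleftrightarrow>
     finite (points G) \<and>
     fpf_involution_on (points G) (free_arc G) \<and>
     fpf_involution_on (points G) (line_seg G) \<and>
     disjoint (edges G) \<and>
     (\<forall>e\<in>edges G. e \<subseteq> points G \<and> card e = 4 \<and>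
        fpf_involution_on e (line_seg G) \<and> fpf_involution_on e (edge_side G) \<and>
        (\<forall>p\<in>e. line_seg G p \<noteq> edge_side G p))"

text \<open>The closed curves formed by two systems of arcs, each given by the set of points on it.\<close>

definition circles :: "'p set \<Rightarrow> ('p \<Rightarrow> 'p) \<Rightarrow> ('p \<Rightarrow> 'p) \<Rightarrow> 'p set set" where
  "circles P f g = P // {(p, q). q = f p \<or> q = g p}\<^sup>*"

text \<open>A vertex is identified with the set of points on its boundary circle.\<close>

definition vertices :: "('p, 'm) ribbon_scheme \<Rightarrow> 'p set set" where
  "vertices G = circles (points G) (free_arc G) (line_seg G)"

text \<open>
  A boundary component of the surface follows the side of an edge where an edge is attached, and
  the line segment itself where none is.
\<close>

definition boundaries :: "('p, 'm) ribbon_scheme \<Rightarrow> 'p set set" where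
  "boundaries G = circles (points G) (free_arc G)
     (\<lambda>p. if p \<in> \<Union>(edges G) then edge_side G p else line_seg G p)"

definition meets :: "'p set \<Rightarrow> 'p set \<Rightarrow> bool" where
  "meets c e \<longleftrightarrow> c \<inter> e \<noteq> {}"

definition delete_edge :: "'p set \<Rightarrow> ('p, 'm) ribbon_scheme \<Rightarrow> ('p, 'm) ribbon_scheme" where
  "delete_edge e G = G\<lparr>edges := edges G - {e}\<rparr>"

text \<open>
  The boundary of the union of \<open>e\<close> and its end vertices consists of the arcs on the circles of the
  end vertices, with the two line segments of \<open>e\<close> replaced by its two sides.  Hence exchanging these
  arcs turns the circles of the end vertices into those of the discs glued in by the contraction.
\<close>

definition contract_edge :: "'p set \<Rightarrow> ('p, 'm) ribbon_scheme \<Rightarrow> ('p, 'm) ribbon_scheme" where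
  "contract_edge e G = G\<lparr>
     line_seg := (\<lambda>p. if p \<in> e then edge_side G p else line_seg G p),
     edges := edges G - {e}\<rparr>"

text \<open>
  Orientability of the union of the disc \<open>u\<close> with \<open>e\<close>: orientations of the disc and the edge are given
  by a direction of their boundary circles, recorded by a sign at each point telling which of the
  two arcs at the point is the outgoing one.
\<close>

definition orientable_union :: "('p, 'm) ribbon_scheme \<Rightarrow> 'p set \<Rightarrow> 'p set \<Rightarrow> bool" where
  "orientable_union G u e \<longleftrightarrow>
     (\<exists>s :: 'p \<Rightarrow> bool. (\<forall>p\<in>u. s (free_arc G p) \<noteq> s p \<and> s (line_seg G p) \<noteq> s p) \<and>
                     (\<forall>p\<in>e. s (edge_side G p) \<noteq> s p))"

definition orientable_loop :: "('p, 'm) ribbon_scheme \<Rightarrow> 'p set \<Rightarrow> bool" where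
  "orientable_loop G e \<longleftrightarrow> (\<exists>u\<in>vertices G. e \<subseteq> u \<and> orientable_union G u e)"

definition non_orientable_loop :: "('p, 'm) ribbon_scheme \<Rightarrow> 'p set \<Rightarrow> bool" where
  "non_orientable_loop G e \<longleftrightarrow> (\<exists>u\<in>vertices G. e \<subseteq> u \<and> \<not> orientable_union G u e)"


section \<open>Coloured ribbon graphs\<close>

record 'p coloured_ribbon = "'p ribbon" +
  vertex_classes :: "'p set set set"
  boundary_classes :: "'p set set set"

definition coloured_ribbon_graph :: "'p coloured_ribbon \<Rightarrow> bool" where
  "coloured_ribbon_graph G \<longleftrightarrow> ribbon_graph G \<and>
     partition_on (vertices G) (vertex_classes G) \<and>
     partition_on (boundaries G) (boundary_classes G)"

text \<open>
  The elements of \<open>old\<close> are replaced by those of \<open>new\<close>; the classes that contain elements of \<open>old\<close>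
  (one class or two, when \<open>old\<close> consists of the cells that an edge meets) become a single class.
\<close>

definition replace_cells :: "'c set \<Rightarrow> 'c set \<Rightarrow> 'c set set \<Rightarrow> 'c set set" where
  "replace_cells old new \<C> =
     insert ((\<Union>{C \<in> \<C>. C \<inter> old \<noteq> {}} - old) \<union> new) {C \<in> \<C>. C \<inter> old = {}}"

definition delete :: "'p set \<Rightarrow> 'p coloured_ribbon \<Rightarrow> 'p coloured_ribbon" where
  "delete e G =
     (let H = delete_edge e G;
          old = {f \<in> boundaries G. meets f e};
          new = boundaries H - (boundaries G - old)
      in H\<lparr>boundary_classes := replace_cells old new (boundary_classes G)\<rparr>)"

definition contract :: "'p set \<Rightarrow> 'p coloured_ribbon \<Rightarrow> 'p coloured_ribbon" where
  "contract e G =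
     (let H = contract_edge e G;
          old = {u \<in> vertices G. meets u e};
          new = vertices H - (vertices G - old)
      in H\<lparr>vertex_classes := replace_cells old new (vertex_classes G)\<rparr>)"

text \<open>
  An isolated vertex has a single boundary component, and both are given by the same set of points.
\<close>

definition remove_isolated :: "'p coloured_ribbon \<Rightarrow> 'p coloured_ribbon" where
  "remove_isolated G =
     (let I = {u \<in> vertices G. \<forall>e\<in>edges G. \<not> meets u e}
      in G\<lparr>points := points G - \<Union>I,
           vertex_classes := (\<lambda>C. C - I) ` vertex_classes G - {{}},
           boundary_classes := (\<lambda>B. B - I) ` boundary_classes G - {{}}\<rparr>)"

definition minor_closed :: "'p coloured_ribbon set \<Rightarrow> bool" where
  "minor_closed \<G> \<longleftrightarrow>
     (\<forall>G\<in>\<G>. coloured_ribbon_graph G \<and> (\<forall>e\<in>edges G. delete e G \<in> \<G> \<and> contract e G \<in> \<G>))"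


section \<open>Edge types\<close>

datatype edge_type = BS | BP | OLC | OLH | NL

definition same_class :: "'c set set \<Rightarrow> 'c \<Rightarrow> 'c \<Rightarrow> bool" where
  "same_class \<C> a b \<longleftrightarrow> (\<exists>C\<in>\<C>. a \<in> C \<and> b \<in> C)"

fun is_single_edge :: "edge_type \<Rightarrow> 'p coloured_ribbon \<Rightarrow> bool" where
  "is_single_edge BS H \<longleftrightarrow> (\<exists>e u v. edges H = {e} \<and> vertices H = {u, v} \<and> u \<noteq> v \<and>
     meets u e \<and> meets v e \<and> \<not> same_class (vertex_classes H) u v)"
| "is_single_edge BP H \<longleftrightarrow> (\<exists>e u v. edges H = {e} \<and> vertices H = {u, v} \<and> u \<noteq> v \<and>
     meets u e \<and> meets v e \<and> same_class (vertex_classes H) u v)"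
| "is_single_edge OLC H \<longleftrightarrow> (\<exists>e u a b. edges H = {e} \<and> vertices H = {u} \<and> orientable_loop H e \<and>
     boundaries H = {a, b} \<and> a \<noteq> b \<and> \<not> same_class (boundary_classes H) a b)"
| "is_single_edge OLH H \<longleftrightarrow> (\<exists>e u a b. edges H = {e} \<and> vertices H = {u} \<and> orientable_loop H e \<and>
     boundaries H = {a, b} \<and> a \<noteq> b \<and> same_class (boundary_classes H) a b)"
| "is_single_edge NL H \<longleftrightarrow> (\<exists>e u. edges H = {e} \<and> vertices H = {u} \<and> non_orientable_loop H e)"

text \<open>
  Contracting or deleting a set of edges means doing so one edge at a time; the result does not
  depend on the order.
\<close>

definition contracts_to :: "'p coloured_ribbon \<Rightarrow> 'p set set \<Rightarrow> 'p coloured_ribbon \<Rightarrow> bool" where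
  "contracts_to G A H \<longleftrightarrow> (\<exists>es. distinct es \<and> set es = A \<and> H = fold contract es G)"

definition deletes_to :: "'p coloured_ribbon \<Rightarrow> 'p set set \<Rightarrow> 'p coloured_ribbon \<Rightarrow> bool" where
  "deletes_to G A H \<longleftrightarrow> (\<exists>es. distinct es \<and> set es = A \<and> H = fold delete es G)"

definition has_type :: "'p coloured_ribbon \<Rightarrow> 'p set \<Rightarrow> edge_type \<Rightarrow> edge_type \<Rightarrow> bool" where
  "has_type G e i j \<longleftrightarrow>
     (\<exists>H. contracts_to G (edges G - {e}) H \<and> is_single_edge i (remove_isolated H)) \<and>
     (\<exists>H. deletes_to G (edges G - {e}) H \<and> is_single_edge j (remove_isolated H))"


section \<open>Rank parameters and the Tutte polynomial\<close>

text \<open>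
  The graph on a set of colour classes in which an edge \<open>e\<close> joins the (one or two) classes of the
  cells it meets.  For vertex classes this is \<open>G/V\<close>, for boundary classes it is \<open>G\<^sup>*/B\<close>.
  Both functions below refer to the spanning subgraph with edge set \<open>A\<close>.
\<close>

definition class_adjacency :: "'p set set set \<Rightarrow> 'p set set \<Rightarrow> ('p set set \<times> 'p set set) set" where
  "class_adjacency \<C> A =
     {(C, D). C \<in> \<C> \<and> D \<in> \<C> \<and> (\<exists>e\<in>A. (\<exists>c\<in>C. meets c e) \<and> (\<exists>d\<in>D. meets d e))}"

definition num_components :: "'p set set set \<Rightarrow> 'p set set \<Rightarrow> nat" where
  "num_components \<C> A = card (\<C> // (class_adjacency \<C> A)\<^sup>*)"

definition class_rank :: "'p set set set \<Rightarrow> 'p set set \<Rightarrow> int" where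
  "class_rank \<C> A = int (card \<C>) - int (num_components \<C> A)"

definition num_boundaries :: "('p, 'm) ribbon_scheme \<Rightarrow> 'p set set \<Rightarrow> nat" where
  "num_boundaries G A = card (boundaries (G\<lparr>edges := A\<rparr>))"

definition rho :: "('p, 'm) ribbon_scheme \<Rightarrow> 'p set set \<Rightarrow> rat" where
  "rho G A = (of_nat (card A) + of_nat (card (vertices G)) - of_nat (num_boundaries G A)) / 2"

definition r1 :: "'p coloured_ribbon \<Rightarrow> 'p set set \<Rightarrow> int" where
  "r1 G A = class_rank (vertex_classes G) A"

definition r2 :: "'p coloured_ribbon \<Rightarrow> 'p set set \<Rightarrow> rat" where
  "r2 G A = rho G A - of_int (class_rank (vertex_classes G) A)"

definition r3 :: "'p coloured_ribbon \<Rightarrow> 'p set set \<Rightarrow> int" where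
  "r3 G A = class_rank (boundary_classes G) (edges G) - class_rank (boundary_classes G) (edges G - A)"

definition r4 :: "'p coloured_ribbon \<Rightarrow> 'p set set \<Rightarrow> rat" where
  "r4 G A = of_nat (card A) + of_int (class_rank (boundary_classes G) (edges G - A))
            - of_int (class_rank (boundary_classes G) (edges G)) - rho G A"

text \<open>
  The power \<open>x\<^sup>q\<close> for \<open>q\<close> in \<open>\<int>/2\<close>, where \<open>s\<close> is the chosen square root of \<open>x\<close>.
\<close>

definition half_power :: "'a :: field \<Rightarrow> rat \<Rightarrow> 'a" where
  "half_power s q = s powi \<lfloor>2 * q\<rfloor>"

text \<open>
  The value of the Tutte polynomial at \<open>w, x, y, z\<close>.  As it is a polynomial in the square roots of
  \<open>x\<close> and \<open>z\<close>, these roots \<open>sx\<close> and \<open>sz\<close> are the arguments.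
\<close>

definition tutte_ps :: "'p coloured_ribbon \<Rightarrow> 'a :: field \<Rightarrow> 'a \<Rightarrow> 'a \<Rightarrow> 'a \<Rightarrow> 'a" where
  "tutte_ps G w sx y sz =
     (\<Sum>A\<in>Pow (edges G).
        w powi (r1 G (edges G) - r1 G A) * half_power sx (r2 G (edges G) - r2 G A) *
        y powi r3 G A * half_power sz (r4 G A))"


section \<open>The coefficient ring\<close>

text \<open>
  The field of fractions of a ring of multivariate integer polynomials contains the coefficient ring
  of the invariant as well as the fractions and the square root of \<open>\<gamma>\<close> that occur when the Tutte
  polynomial is evaluated.
\<close>

type_synonym rat_fun = "((nat \<Rightarrow>\<^sub>0 nat) \<Rightarrow>\<^sub>0 int) fract"

definition indet :: "nat \<Rightarrow> rat_fun" where
  "indet i = Fract (Poly_Mapping.single (Poly_Mapping.single i 1) 1) 1"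

definition \<alpha> :: rat_fun where "\<alpha> = indet 0"
definition \<beta> :: rat_fun where "\<beta> = indet 1"
definition sqrt_\<gamma> :: rat_fun where "sqrt_\<gamma> = indet 2"
definition \<gamma> :: rat_fun where "\<gamma> = sqrt_\<gamma> ^ 2"
definition a_bs :: rat_fun where "a_bs = indet 3"
definition sqrt_a_bp :: rat_fun where "sqrt_a_bp = indet 4"
definition a_olc :: rat_fun where "a_olc = indet 5"
definition sqrt_a_olh :: rat_fun where "sqrt_a_olh = indet 6"
definition b_bs :: rat_fun where "b_bs = indet 7"
definition sqrt_b_bp :: rat_fun where "sqrt_b_bp = indet 8"
definition b_olc :: rat_fun where "b_olc = indet 9"
definition sqrt_b_olh :: rat_fun where "sqrt_b_olh = indet 10"

fun coeff_a :: "edge_type \<Rightarrow> rat_fun" where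
  "coeff_a BS = a_bs"
| "coeff_a BP = sqrt_a_bp ^ 2"
| "coeff_a OLC = a_olc"
| "coeff_a OLH = sqrt_a_olh ^ 2"
| "coeff_a NL = sqrt_a_bp * sqrt_a_olh"

fun coeff_b :: "edge_type \<Rightarrow> rat_fun" where
  "coeff_b BS = b_bs"
| "coeff_b BP = sqrt_b_bp ^ 2"
| "coeff_b OLC = b_olc"
| "coeff_b OLH = sqrt_b_olh ^ 2"
| "coeff_b NL = sqrt_b_bp * sqrt_b_olh"

text \<open>The subring \<open>\<int>[S]\<close> generated by \<open>S\<close>.\<close>

inductive_set int_adjoin :: "'a :: comm_ring_1 set \<Rightarrow> 'a set" for S where
  one: "1 \<in> int_adjoin S"
| gen: "x \<in> S \<Longrightarrow> x \<in> int_adjoin S"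
| diff: "x \<in> int_adjoin S \<Longrightarrow> y \<in> int_adjoin S \<Longrightarrow> x - y \<in> int_adjoin S"
| mult: "x \<in> int_adjoin S \<Longrightarrow> y \<in> int_adjoin S \<Longrightarrow> x * y \<in> int_adjoin S"

definition coeff_ring :: "rat_fun set" where
  "coeff_ring = int_adjoin {\<alpha>, \<beta>, \<gamma>, a_bs, sqrt_a_bp, a_olc, sqrt_a_olh,
                            b_bs, sqrt_b_bp, b_olc, sqrt_b_olh}"

definition deletion_contraction_invariant ::
    "'p coloured_ribbon set \<Rightarrow> ('p coloured_ribbon \<Rightarrow> rat_fun) \<Rightarrow> bool" where
  "deletion_contraction_invariant \<G> U \<longleftrightarrow>
     (\<forall>G\<in>\<G>. \<forall>e\<in>edges G. \<forall>i j. has_type G e i j \<longrightarrow>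
        U G = coeff_a i * U (delete e G) + coeff_b j * U (contract e G)) \<and>
     (\<forall>G\<in>\<G>. edges G = {} \<longrightarrow>
        U G = \<alpha> ^ card (vertex_classes G) * \<beta> ^ card (boundary_classes G) * \<gamma> ^ card (vertices G))"

end

theory Submission
  imports Defs
begin

text \<open>
  Substituting the definitions turns the right-hand side into a state sum over \<open>A \<subseteq> E\<close>: with
  \<open>k(A)\<close> and \<open>l(A)\<close> the numbers of components of \<open>G/V\<close> on \<open>A\<close> and of \<open>G\<^sup>*/B\<close> on \<open>E - A\<close>, the term of
  \<open>A\<close> is \<open>\<alpha>\<^bsup>k(A)\<^esup> \<beta>\<^bsup>l(A)\<^esup> \<gamma>\<^bsup>b(A)\<^esup>\<close> times a monomial in the \<open>b\<close>'s with the rank parameters of \<open>A\<close> as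
  exponents and one in the \<open>a\<close>'s with those of \<open>E\<close> minus those of \<open>A\<close>.  The numbers \<open>k\<close>, \<open>l\<close>, \<open>b\<close>
  are invariant under deletion of \<open>e \<notin> A\<close> and under contraction of \<open>e \<in> A\<close>, so the terms change by
  monomials with the exponents \<open>r(E) - r(E - e)\<close> and \<open>r({e})\<close>.  By the same invariance these exponents
  can be read off the one-edge minors that define the type \<open>(i, j)\<close> of \<open>e\<close>, where they are those of
  \<open>a\<^sub>i\<close> and \<open>b\<^sub>j\<close>.  Every edge has a type, because the three ways of joining the four points
  of an edge by paths outside it give two ends, an orientable or a non-orientable loop.  Uniqueness
  and membership in the coefficient ring then follow by induction on the number of edges.
\<close>

section \<open>Circles of arcs\<close>

text \<open>Naming the relation inside \<open>circles\<close> lets its closure be handled by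
  induction along walks.\<close>

definition arcs :: "('p \<Rightarrow> 'p) \<Rightarrow> ('p \<Rightarrow> 'p) \<Rightarrow> ('p \<times> 'p) set" where
  "arcs f g = {(p, q). q = f p \<or> q = g p}"

lemma circles_arcs: "circles P f g = P // (arcs f g)\<^sup>*"
  by (simp add: circles_def arcs_def)

lemma fpf_involution_onD:
  assumes "fpf_involution_on S f" "p \<in> S"
  shows "f p \<in> S" "f p \<noteq> p" "f (f p) = p"
  using assms by (auto simp: fpf_involution_on_def)

lemma arcs_rtrancl_closed:
  assumes "(p, q) \<in> (arcs f g)\<^sup>*" "p \<in> W" "f ` W \<subseteq> W" "g ` W \<subseteq> W"
  shows "q \<in> W"
  using assms by (induction) (auto simp: arcs_def)

text \<open>Arcs can be walked backwards because both maps are involutions on \<open>P\<close>. So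
  the closure is symmetric there, and any point of a circle can represent it.\<close>

lemma arcs_rtrancl_sym:
  assumes "fpf_involution_on P f" "fpf_involution_on P g" "(p, q) \<in> (arcs f g)\<^sup>*" "p \<in> P"
  shows "q \<in> P \<and> (q, p) \<in> (arcs f g)\<^sup>*"
  using assms(3)
proof induction
  case base
  then show ?case using assms(4) by simp
next
  case (step y z)
  then have "z \<in> P" "(z, y) \<in> arcs f g"
    using assms(1,2) by (auto simp: arcs_def fpf_involution_on_def)
  with step.IH show ?case using converse_rtrancl_into_rtrancl[of z y "arcs f g" p] by simp
qed

lemma circle_eq:
  assumes "fpf_involution_on P f" "fpf_involution_on P g" "c \<in> circles P f g" "p \<in> c"
  shows "p \<in> P \<and> c = (arcs f g)\<^sup>* `` {p}"
proof -
  obtain x where x: "x \<in> P" "c = (arcs f g)\<^sup>* `` {x}"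
    using assms(3) by (auto simp: circles_arcs elim: quotientE)
  then have xp: "(x, p) \<in> (arcs f g)\<^sup>*" using assms(4) by auto
  have p: "p \<in> P" "(p, x) \<in> (arcs f g)\<^sup>*" using arcs_rtrancl_sym[OF assms(1,2) xp x(1)] by auto
  have "(arcs f g)\<^sup>* `` {x} = (arcs f g)\<^sup>* `` {p}"
    using rtrancl_trans[OF xp] rtrancl_trans[OF p(2)] by blast
  with x p show ?thesis by simp
qed

lemma circle_closed:
  assumes "fpf_involution_on P f" "fpf_involution_on P g" "c \<in> circles P f g"
  shows "f ` c \<subseteq> c" "g ` c \<subseteq> c"
  using assms(3) by (auto simp: circles_arcs arcs_def elim!: quotientE intro: rtrancl_into_rtrancl)

lemma partition_on_circles:
  assumes "fpf_involution_on P f" "fpf_involution_on P g"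
  shows "partition_on P (circles P f g)"
proof (rule partition_onI)
  have "p \<in> \<Union> (circles P f g)" if "p \<in> P" for p
    using quotientI[OF that, of "(arcs f g)\<^sup>*"] by (auto simp: circles_arcs)
  then show "\<Union> (circles P f g) = P"
    using circle_eq[OF assms] by blast
next
  fix c d assume "c \<in> circles P f g" "d \<in> circles P f g" "c \<noteq> d"
  then show "disjnt c d"
    unfolding disjnt_def using circle_eq[OF assms] by (metis disjoint_iff)
next
  show "{} \<notin> circles P f g" by (auto simp: circles_arcs quotient_def)
qed

text \<open>Off \<open>e\<close> the two arc systems agree, so a circle of one that avoids
  \<open>e\<close> is closed under the other as well. This is why deletion and contraction alter
  only cells that meet the edge.\<close>

lemma circles_avoiding_subset:
  assumes "fpf_involution_on P f" "fpf_involution_on P g"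
    and "fpf_involution_on P g'" "\<And>p. p \<in> P - e \<Longrightarrow> g' p = g p"
  shows "{c \<in> circles P f g. c \<inter> e = {}} \<subseteq> circles P f g'"
proof clarify
  fix c assume c: "c \<in> circles P f g" "c \<inter> e = {}"
  then obtain p where p: "p \<in> P" "p \<in> c" "c = (arcs f g)\<^sup>* `` {p}"
    by (auto simp: circles_arcs elim: quotientE)
  have "c \<subseteq> P" using circle_eq[OF assms(1,2) c(1)] by auto
  define d where "d = (arcs f g')\<^sup>* `` {p}"
  have d: "d \<in> circles P f g'" using p by (auto simp: d_def circles_arcs quotientI)
  have gc: "g' x = g x" if "x \<in> c" for x
    using that assms(4) \<open>c \<subseteq> P\<close> c(2) by blast
  have "g' ` c \<subseteq> c" using gc circle_closed(2)[OF assms(1,2) c(1)] by auto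
  then have "d \<subseteq> c"
    using arcs_rtrancl_closed[of p _ f g' c] p circle_closed(1)[OF assms(1,2) c(1)]
    by (auto simp: d_def)
  \<comment> \<open>Inside \<open>c\<close> the maps agree, so \<open>d\<close> is closed under
    \<open>g\<close> too, which gives the reverse inclusion.\<close>
  then have "g ` d \<subseteq> d" using circle_closed(2)[OF assms(1,3) d] gc by fastforce
  then have "c \<subseteq> d"
    using arcs_rtrancl_closed[of p _ f g d] p circle_closed(1)[OF assms(1,3) d]
    by (auto simp: d_def)
  with \<open>d \<subseteq> c\<close> d show "c \<in> circles P f g'" by simp
qed

lemma circles_avoiding:
  assumes "fpf_involution_on P f" "fpf_involution_on P g"
    and "fpf_involution_on P g'" "\<And>p. p \<in> P - e \<Longrightarrow> g' p = g p"
  shows "{c \<in> circles P f g. c \<inter> e = {}} = {c \<in> circles P f g'. c \<inter> e = {}}"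
  using circles_avoiding_subset[of P f g g' e] circles_avoiding_subset[of P f g' g e] assms
  by fastforce

section \<open>Alternating colourings and paths\<close>

text \<open>\<open>g \<circ> f\<close> is one step of an alternating walk; applying \<open>g\<close>
  and then \<open>f\<close> undoes it.\<close>

lemma inj_on_comp_involutions:
  assumes "fpf_involution_on P f" "fpf_involution_on P g"
  shows "inj_on (g \<circ> f) P" "(g \<circ> f) ` P \<subseteq> P"
proof -
  have "f (g ((g \<circ> f) x)) = x" if "x \<in> P" for x
    using that assms by (simp add: fpf_involution_on_def)
  then show "inj_on (g \<circ> f) P" by (intro inj_on_inverseI[where g = "\<lambda>y. f (g y)"])
  show "(g \<circ> f) ` P \<subseteq> P" using assms by (auto simp: fpf_involution_on_def)
qed

text \<open>
  An alternating walk from \<open>x\<close> to \<open>f x\<close> would be a palindrome, and its middle arc would join a point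
  to itself.
\<close>

lemma no_reflection:
  assumes "fpf_involution_on P f" "fpf_involution_on P g" "x \<in> P"
  shows "f x \<noteq> ((g \<circ> f) ^^ n) x"
  using assms(3)
proof (induction n arbitrary: x rule: induct_nat_012)
  case 0
  then show ?case using assms(1) by (simp add: fpf_involution_on_def)
next
  case 1
  then show ?case using assms(1,2) by (simp, metis fpf_involution_onD)
next
  case (ge2 n)
  let ?h = "g \<circ> f"
  show ?case
  proof
    assume *: "f x = (?h ^^ Suc (Suc n)) x"
    let ?y = "?h x"
    have y: "?y \<in> P" using ge2.prems assms by (simp add: fpf_involution_onD)
    have hP: "(?h ^^ m) z \<in> P" if "z \<in> P" for m z
      using that by (induction m) (auto simp: fpf_involution_onD[OF assms(1)] fpf_involution_onD[OF assms(2)])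
    \<comment> \<open>Cutting one application of \<open>?h\<close> off each end of the palindrome
      leaves a shorter one, from \<open>?y\<close> to \<open>f ?y\<close> in \<open>n\<close>
      steps.\<close>
    have "?h (f ?y) = f x"
      using ge2.prems assms by (simp add: fpf_involution_onD)
    also have "\<dots> = ?h ((?h ^^ n) ?y)"
      using * by (simp add: funpow_swap1)
    finally have "f ?y = (?h ^^ n) ?y"
      using inj_onD[OF inj_on_comp_involutions(1)[OF assms(1,2)]] hP[OF y, of n]
        fpf_involution_onD(1)[OF assms(1) y] by blast
    then show False using ge2.IH(1)[OF y] by blast
  qed
qed

text \<open>By the pigeonhole principle some iterate repeats, and injectivity cancels the common
  initial steps. The form \<open>Suc n\<close> makes the return time positive.\<close>

lemma funpow_return:
  assumes "finite P" "h ` P \<subseteq> P" "inj_on h P" "p \<in> P"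
  obtains n where "(h ^^ Suc n) p = p"
proof -
  have P: "(h ^^ m) p \<in> P" for m
    using assms(2,4) by (induction m) auto
  then have "\<not> inj (\<lambda>n. (h ^^ n) p)"
    using assms(1) by (metis (no_types, lifting) finite_imageD finite_subset image_subsetI infinite_UNIV_nat)
  then obtain i j where ij: "(h ^^ i) p = (h ^^ j) p" "i < j"
    by (metis (mono_tags, lifting) injI linorder_neqE_nat)
  have "(h ^^ (i + k)) p = (h ^^ i) p \<Longrightarrow> (h ^^ k) p = p" for i k
  proof (induction i)
    case (Suc i)
    then show ?case using inj_onD[OF assms(3)] P by (metis add_Suc comp_apply funpow.simps(2))
  qed simp
  from this[of i "j - i"] ij have "(h ^^ (j - i)) p = p" by simp
  then show thesis using that[of "j - i - 1"] ij(2) by (metis Suc_diff_1 zero_less_diff)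
qed

text \<open>A circle consists of the orbit of a point under \<open>g \<circ> f\<close> and the image
  of this orbit under \<open>f\<close>. These are disjoint by \<open>no_reflection\<close> and serve
  as the two colour classes.\<close>

lemma alternating_colouring:
  assumes "finite P" "fpf_involution_on P f" "fpf_involution_on P g" "u \<in> circles P f g"
  shows "\<exists>s :: 'a \<Rightarrow> bool. \<forall>p\<in>u. s (f p) \<noteq> s p \<and> s (g p) \<noteq> s p"
proof -
  let ?h = "g \<circ> f"
  obtain p where p: "p \<in> P" "u = (arcs f g)\<^sup>* `` {p}"
    using assms(4) by (auto simp: circles_arcs elim: quotientE)
  define M where "M = range (\<lambda>n. (?h ^^ n) p)"
  have hP: "(?h ^^ m) p \<in> P" for m
    using p by (induction m) (auto simp: fpf_involution_onD[OF assms(2)] fpf_involution_onD[OF assms(3)])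
  then have "M \<subseteq> P" by (auto simp: M_def)
  obtain N where N: "(?h ^^ Suc N) p = p"
    using funpow_return[OF assms(1)] inj_on_comp_involutions[OF assms(2,3)] p by metis
  \<comment> \<open>Whichever of \<open>x\<close> and \<open>f x\<close> comes first on the orbit is
    carried to its \<open>f\<close>-partner by iteration of \<open>?h\<close>, which
    \<open>no_reflection\<close> excludes.\<close>
  have fM: "f x \<notin> M" if xM: "x \<in> M" for x
  proof
    assume "f x \<in> M"
    then obtain m n where mn: "x = (?h ^^ m) p" "f x = (?h ^^ n) p"
      using xM unfolding M_def by blast
    have xP: "x \<in> P" using that \<open>M \<subseteq> P\<close> by auto
    show False
    proof (cases "m \<le> n")
      case True
      then have "(?h ^^ n) p = (?h ^^ (n - m)) ((?h ^^ m) p)"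
        using funpow_add[of "n - m" m ?h] by simp
      with mn no_reflection[OF assms(2,3) xP, of "n - m"] show False by simp
    next
      case False
      then have "(?h ^^ m) p = (?h ^^ (m - n)) ((?h ^^ n) p)"
        using funpow_add[of "m - n" n ?h] by simp
      moreover have "f (f x) = x" "f x \<in> P" using xP assms(2) by (auto simp: fpf_involution_on_def)
      ultimately show False
        using no_reflection[OF assms(2,3) \<open>f x \<in> P\<close>, of "m - n"] mn by simp
    qed
  qed
  have gM: "g x \<in> f ` M" if "x \<in> M" for x
  proof -
    obtain m where m: "x = (?h ^^ m) p" using \<open>x \<in> M\<close> unfolding M_def by blast
    \<comment> \<open>For index 0 the return time \<open>N\<close> supplies a predecessor on the
      orbit.\<close>
    obtain n where n: "x = (?h ^^ Suc n) p"
    proof (cases m)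
      case 0
      then show thesis using that[of N] m N by simp
    qed (use that m in blast)
    then have "g x = f ((?h ^^ n) p)"
      using hP[of n] assms by (simp add: fpf_involution_onD)
    then show ?thesis by (auto simp: M_def)
  qed
  have gfM: "g (f x) \<in> M" if xM: "x \<in> M" for x
  proof -
    obtain m where "x = (?h ^^ m) p" using xM unfolding M_def by blast
    then have "g (f x) = (?h ^^ Suc m) p" by simp
    then show ?thesis unfolding M_def by blast
  qed
  have ffM: "f (f x) = x" if "x \<in> M" for x
    using that \<open>M \<subseteq> P\<close> assms(2) by (auto simp: fpf_involution_on_def)
  have pM: "p \<in> M" unfolding M_def by (metis funpow_0 rangeI)
  have "u \<subseteq> M \<union> f ` M"
  proof
    fix x assume "x \<in> u"
    then have "(p, x) \<in> (arcs f g)\<^sup>*" using p by auto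
    then show "x \<in> M \<union> f ` M"
      by (rule arcs_rtrancl_closed) (use pM gM gfM ffM in auto)
  qed
  moreover have "M \<inter> f ` M = {}" using fM by blast
  ultimately have "\<forall>x\<in>u. (f x \<in> M) \<noteq> (x \<in> M) \<and> (g x \<in> M) \<noteq> (x \<in> M)"
    using fM gM gfM ffM by (auto simp: disjoint_iff)
  then show ?thesis by (intro exI[of _ "\<lambda>x. x \<in> M"]) auto
qed

text \<open>
  \<open>W\<close> is the path from \<open>p\<close> to the next point \<open>q\<close> of \<open>e\<close>.  It starts and ends with an \<open>f\<close>-arc, so
  alternating colours differ at its ends.
\<close>

lemma path_avoiding:
  assumes "finite P" "fpf_involution_on P f" "fpf_involution_on P g" "e \<subseteq> P"
    and "fpf_involution_on e g" "p \<in> e"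
  obtains q W where "q \<in> e" "q \<noteq> p" "W \<inter> e = {p, q}" "f ` W \<subseteq> W" "g ` (W - e) \<subseteq> W"
    "(p, q) \<in> {(x, y). y = f x \<or> x \<notin> e \<and> y = g x}\<^sup>*"
    "\<And>s :: 'a \<Rightarrow> bool. \<forall>x\<in>(arcs f g)\<^sup>* `` {p}. s (f x) \<noteq> s x \<and> s (g x) \<noteq> s x \<Longrightarrow> s q \<noteq> s p"
proof -
  let ?h = "g \<circ> f" and ?R = "{(x, y). y = f x \<or> x \<notin> e \<and> y = g x}"
  let ?x = "\<lambda>n. (?h ^^ n) p"
  have p: "p \<in> P" using assms by auto
  have hP: "?x m \<in> P" for m
    using p by (induction m) (auto simp: fpf_involution_onD[OF assms(2)] fpf_involution_onD[OF assms(3)])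
  obtain N where N: "?x (Suc N) = p"
    using funpow_return[OF assms(1)] inj_on_comp_involutions[OF assms(2,3)] p by metis
  \<comment> \<open>The walk returns to \<open>p\<close> along a \<open>g\<close>-arc, whose other
    end lies in \<open>e\<close> since \<open>g\<close> preserves \<open>e\<close>. So some
    \<open>f\<close>-arc of the walk ends in \<open>e\<close>, and the first such arc determines
    \<open>q\<close>.\<close>
  have "g p = g (g (f (?x N)))" using N by simp
  also have "\<dots> = f (?x N)" using hP[of N] assms(2,3) by (simp add: fpf_involution_onD)
  finally have ex: "\<exists>k. f (?x k) \<in> e" using fpf_involution_onD(1)[OF assms(5,6)] by metis
  define k where "k = (LEAST k. f (?x k) \<in> e)"
  define q where "q = f (?x k)"
  have qe: "q \<in> e" unfolding q_def k_def using ex by (rule LeastI_ex)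
  have less: "f (?x i) \<notin> e" if "i < k" for i
    using not_less_Least[of i "\<lambda>k. f (?x k) \<in> e"] that unfolding k_def by blast
  have xS: "?x (Suc i) = g (f (?x i))" for i by simp
  \<comment> \<open>As \<open>g\<close> preserves both \<open>e\<close> and its complement in
    \<open>P\<close>, the walk can enter \<open>e\<close> only along an
    \<open>f\<close>-arc.\<close>
  have ge: "g y \<in> e \<longleftrightarrow> y \<in> e" if "y \<in> P" for y
  proof -
    have "g (g y) = y" using assms(3) that by (simp add: fpf_involution_onD)
    then show ?thesis using assms(5) by (metis fpf_involution_on_def)
  qed
  have xnot: "?x (Suc i) \<notin> e" if "i < k" for i
    unfolding xS using less[OF that] ge hP[of i] fpf_involution_onD(1)[OF assms(2)] by blast
  define W where "W = ?x ` {..k} \<union> (f \<circ> ?x) ` {..k}"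
  have "W \<inter> e \<subseteq> {p, q}"
  proof
    fix y assume "y \<in> W \<inter> e"
    then obtain i where i: "i \<le> k" "y = ?x i \<or> y = f (?x i)" and "y \<in> e" by (auto simp: W_def)
    from i(2) show "y \<in> {p, q}"
    proof
      assume "y = ?x i"
      then show ?thesis using xnot[of "i - 1"] i(1) \<open>y \<in> e\<close> by (cases i) auto
    next
      assume "y = f (?x i)"
      then show ?thesis using less[of i] i(1) \<open>y \<in> e\<close> by (cases "i = k") (auto simp: q_def)
    qed
  qed
  moreover have "p \<in> W" "q \<in> W"
    using imageI[of 0 "{..k}" ?x] by (simp_all add: W_def q_def image_iff) blast
  ultimately have We: "W \<inter> e = {p, q}" using qe assms(6) by auto
  have fW: "f ` W \<subseteq> W"
    using hP assms(2) by (auto simp: W_def fpf_involution_onD)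
  have gW: "g ` (W - e) \<subseteq> W"
  proof
    fix y assume "y \<in> g ` (W - e)"
    then obtain z i where z: "y = g z" "z \<notin> e" "i \<le> k" "z = ?x i \<or> z = f (?x i)"
      by (auto simp: W_def)
    from z(4) show "y \<in> W"
    proof
      assume zi: "z = ?x i"
      then obtain j where j: "i = Suc j" using z(2) assms(6) by (cases i) auto
      then have "y = f (?x j)"
        using zi z(1) hP[of j] assms by (simp add: fpf_involution_onD)
      then show ?thesis using j z(3) by (auto simp: W_def)
    next
      assume zi: "z = f (?x i)"
      then have "i < k" using z(2,3) qe q_def by (metis le_neq_implies_less)
      moreover have "y = ?x (Suc i)" using zi z(1) by simp
      ultimately show ?thesis unfolding W_def by (metis Suc_leI UnI1 atMost_iff imageI)
    qed
  qed
  have path: "(p, f (?x i)) \<in> ?R\<^sup>*" if "i \<le> k" for i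
    using that
  proof (induction i)
    case 0
    then show ?case by (auto intro: r_into_rtrancl)
  next
    case (Suc i)
    have "(f (?x i), ?x (Suc i)) \<in> ?R" using less[of i] Suc.prems by simp
    moreover have "(?x (Suc i), f (?x (Suc i))) \<in> ?R" by simp
    ultimately show ?case using Suc by (meson Suc_leD rtrancl.rtrancl_into_rtrancl)
  qed
  have alt: "s q \<noteq> s p"
    if s: "\<forall>x\<in>(arcs f g)\<^sup>* `` {p}. s (f x) \<noteq> s x \<and> s (g x) \<noteq> s x" for s :: "'a \<Rightarrow> bool"
  proof -
    have "(p, ?x i) \<in> (arcs f g)\<^sup>* \<and> s (?x i) = s p" for i
    proof (induction i)
      case (Suc i)
      have 1: "(p, f (?x i)) \<in> (arcs f g)\<^sup>*"
        by (rule rtrancl_into_rtrancl[OF conjunct1[OF Suc]]) (simp add: arcs_def comp_def)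
      have 2: "(p, g (f (?x i))) \<in> (arcs f g)\<^sup>*"
        by (rule rtrancl_into_rtrancl[OF 1]) (simp add: arcs_def)
      have "s (f (?x i)) \<noteq> s (?x i)" "s (g (f (?x i))) \<noteq> s (f (?x i))"
        using s Suc 1 by blast+
      then show ?case unfolding xS using Suc 2 by blast
    qed simp
    then show ?thesis using s unfolding q_def by blast
  qed
  have "(arcs f g)\<^sup>* `` {p} \<in> circles P f g" using p by (auto simp: circles_arcs quotientI)
  \<comment> \<open>An alternating colouring exists and separates \<open>q\<close> from
    \<open>p\<close>, so the two points are distinct.\<close>
  from alternating_colouring[OF assms(1-3) this] alt have "q \<noteq> p" by metis
  with that[OF qe _ We fW gW] path[of k] alt show thesis by (auto simp: q_def)
qed

section \<open>The circles at an edge\<close>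

lemma circles_meeting:
  assumes "fpf_involution_on P f" "fpf_involution_on P g" "e \<subseteq> P"
  shows "{c \<in> circles P f g. meets c e} = (\<lambda>x. (arcs f g)\<^sup>* `` {x}) ` e"
proof (intro equalityI subsetI)
  fix c assume "c \<in> {c \<in> circles P f g. meets c e}"
  then obtain x where "c \<in> circles P f g" "x \<in> c" "x \<in> e" by (auto simp: meets_def)
  then show "c \<in> (\<lambda>x. (arcs f g)\<^sup>* `` {x}) ` e"
    using circle_eq[OF assms(1,2)] by blast
next
  fix c assume "c \<in> (\<lambda>x. (arcs f g)\<^sup>* `` {x}) ` e"
  then show "c \<in> {c \<in> circles P f g. meets c e}"
    using assms(3) by (auto simp: meets_def circles_arcs intro!: quotientI)
qed

lemma circle_cong:
  assumes "fpf_involution_on P f" "fpf_involution_on P g" "p \<in> P" "(p, q) \<in> (arcs f g)\<^sup>*"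
  shows "(arcs f g)\<^sup>* `` {q} = (arcs f g)\<^sup>* `` {p}"
proof -
  have "(arcs f g)\<^sup>* `` {p} \<in> circles P f g" using assms(3) by (auto simp: circles_arcs quotientI)
  then show ?thesis using circle_eq[OF assms(1,2)] assms(4) by blast
qed

text \<open>The arcs of \<open>g\<close> pair the four points of \<open>e\<close>, so at most two
  circles meet \<open>e\<close>; the closed set \<open>W\<close> keeps the two pairs apart.\<close>

lemma two_circles:
  assumes "fpf_involution_on P f" "fpf_involution_on P g" "e = {p, g p, s, g s}" "e \<subseteq> P"
    and "p \<in> W" "f ` W \<subseteq> W" "g ` W \<subseteq> W" "s \<notin> W"
  shows "card {c \<in> circles P f g. meets c e} = 2"
proof -
  let ?C = "\<lambda>x. (arcs f g)\<^sup>* `` {x}"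
  have g: "?C (g x) = ?C x" if "x \<in> P" for x
    by (rule circle_cong[OF assms(1,2) that]) (auto simp: arcs_def)
  have "s \<notin> ?C p" using arcs_rtrancl_closed[of p s f g W] assms by auto
  then have "?C p \<noteq> ?C s" by auto
  moreover have "{c \<in> circles P f g. meets c e} = {?C p, ?C s}"
    unfolding circles_meeting[OF assms(1,2,4)] using g[of p] g[of s] assms(3,4) by blast
  ultimately show ?thesis by simp
qed

text \<open>The walk from \<open>p\<close> links the two pairs formed by \<open>g\<close>, so all
  four points lie on one circle.\<close>

lemma one_circle:
  assumes "fpf_involution_on P f" "fpf_involution_on P g" "e = {p, g p, s, g s}" "e \<subseteq> P"
    and "(p, s) \<in> (arcs f g)\<^sup>* \<or> (p, g s) \<in> (arcs f g)\<^sup>*"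
  shows "{c \<in> circles P f g. meets c e} = {(arcs f g)\<^sup>* `` {p}}" "e \<subseteq> (arcs f g)\<^sup>* `` {p}"
proof -
  let ?C = "\<lambda>x. (arcs f g)\<^sup>* `` {x}"
  have g: "?C (g x) = ?C x" if "x \<in> P" for x
    by (rule circle_cong[OF assms(1,2) that]) (auto simp: arcs_def)
  have P: "p \<in> P" "s \<in> P" using assms(3,4) by auto
  have s: "?C s = ?C p"
    using assms(5)
  proof
    assume "(p, g s) \<in> (arcs f g)\<^sup>*"
    from trans[OF g[OF P(2), symmetric] circle_cong[OF assms(1,2) P(1) this]] show ?thesis .
  qed (rule circle_cong[OF assms(1,2) P(1)])
  have C: "?C x = ?C p" if "x \<in> e" for x
    using that unfolding assms(3) by (elim insertE emptyE) (metis g P s)+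
  have "?C ` e = (\<lambda>x. ?C p) ` e" by (rule image_cong[OF refl C])
  also have "\<dots> = {?C p}" by (rule image_constant[of p]) (simp add: assms(3))
  finally show "{c \<in> circles P f g. meets c e} = {?C p}"
    unfolding circles_meeting[OF assms(1,2,4)] .
  show "e \<subseteq> ?C p" using C by blast
qed

text \<open>
  Outside \<open>e\<close> the arcs form paths joining the four points of \<open>e\<close> in pairs.  The three ways of
  pairing them are those of an edge with two ends, an orientable and a non-orientable loop.
\<close>

lemma attached_edge_cases:
  assumes "finite P" "fpf_involution_on P f" "fpf_involution_on P g" "fpf_involution_on P g'"
    and "e \<subseteq> P" "card e = 4" "fpf_involution_on e g" "fpf_involution_on e g'"
    and ne: "\<And>x. x \<in> e \<Longrightarrow> g x \<noteq> g' x" and off: "\<And>x. x \<notin> e \<Longrightarrow> g' x = g x"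
  defines "V \<equiv> {c \<in> circles P f g. meets c e}"
    and "B \<equiv> {c \<in> circles P f g'. meets c e}"
    and "orientable u \<equiv> \<exists>s :: 'a \<Rightarrow> bool. (\<forall>x\<in>u. s (f x) \<noteq> s x \<and> s (g x) \<noteq> s x) \<and>
           (\<forall>x\<in>e. s (g' x) \<noteq> s x)"
  shows "card V = 2 \<and> card B = 1 \<or>
    (\<exists>u. V = {u} \<and> e \<subseteq> u \<and>
         (card B = 2 \<and> orientable u \<or> card B = 1 \<and> \<not> orientable u))"
proof -
  note [simp] = fpf_involution_onD[OF assms(7)] fpf_involution_onD[OF assms(8)]
  \<comment> \<open>The four points in cyclic order around the edge disc are \<open>p\<close>,
    \<open>q\<close>, \<open>t\<close>, \<open>s\<close>: line segments join \<open>p\<close> to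
    \<open>q\<close> and \<open>s\<close> to \<open>t\<close>, sides join \<open>p\<close> to
    \<open>s\<close> and \<open>q\<close> to \<open>t\<close>.\<close>
  obtain p where p: "p \<in> e" using assms(6) by fastforce
  define q where "q = g p"
  define s where "s = g' p"
  define t where "t = g' q"
  have e4: "q \<in> e" "s \<in> e" "t \<in> e" using p by (auto simp: q_def s_def t_def)
  have inv: "g q = p" "g' s = p" "g' t = q" using p e4 by (auto simp: q_def s_def t_def)
  have d: "p \<noteq> q" "p \<noteq> s" "q \<noteq> s" "p \<noteq> t" "q \<noteq> t" "s \<noteq> t"
    using p e4 ne[of p] fpf_involution_onD[OF assms(7) p] fpf_involution_onD[OF assms(8) p]
      fpf_involution_onD[OF assms(8) e4(1)] inv unfolding q_def s_def t_def by metis+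
  have "finite e" using assms(6) card.infinite by fastforce
  then have e: "{p, q, s, t} = e"
    by (rule card_subset_eq) (use p e4 d assms(6) in auto)
  have "g s \<in> e" "g s \<noteq> s" "g s \<noteq> p" "g s \<noteq> q"
    using fpf_involution_onD[OF assms(7) e4(2)] inv d q_def by metis+
  then have gs: "g s = t" using e by blast
  obtain r W where rW: "r \<in> e" "r \<noteq> p" "W \<inter> e = {p, r}" "f ` W \<subseteq> W" "g ` (W - e) \<subseteq> W"
    "(p, r) \<in> {(x, y). y = f x \<or> x \<notin> e \<and> y = g x}\<^sup>*"
    "\<And>c :: 'a \<Rightarrow> bool. \<forall>x\<in>(arcs f g)\<^sup>* `` {p}. c (f x) \<noteq> c x \<and> c (g x) \<noteq> c x \<Longrightarrow> c r \<noteq> c p"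
    using path_avoiding[OF assms(1-3,5,7) p] by blast
  have pr: "(p, r) \<in> (arcs f g)\<^sup>*" "(p, r) \<in> (arcs f g')\<^sup>*"
    by (rule subsetD[OF rtrancl_mono rW(6)], use off in \<open>auto simp: arcs_def\<close>)+
  have eg: "e = {p, g p, s, g s}" and eg': "e = {p, g' p, q, g' q}"
    using e gs by (auto simp: q_def s_def t_def)
  have gW: "g x \<in> W" if "x \<in> W" "x \<notin> e" for x using that rW(5) by auto
  have pW: "p \<in> W" "r \<in> W" using rW(3) by auto
  note one = one_circle[OF assms(2,3) eg assms(5)] and one' = one_circle[OF assms(2,4) eg' assms(5)]
  \<comment> \<open>The sides pair \<open>p\<close> with \<open>s\<close> and \<open>q\<close> with
    \<open>t\<close>; a path from \<open>p\<close> to \<open>q\<close> or \<open>t\<close> links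
    these pairs.\<close>
  have card_one: "card B = 1" if "r = q \<or> r = t"
    using one'(1) that pr(2) by (auto simp: B_def t_def)
  let ?u = "(arcs f g)\<^sup>* `` {p}"
  have u: "?u \<in> circles P f g" using p assms(5) by (auto simp: circles_arcs quotientI)
  consider "r = q" | "r = s" | "r = t" using rW(1,2) e by auto
  then show ?thesis
  proof cases
    \<comment> \<open>The path joins the ends of one line segment and closes up with it, separating
      the two segments into two vertices.\<close>
    case 1
    have "g ` W \<subseteq> W"
    proof clarify
      fix x assume x: "x \<in> W"
      show "g x \<in> W"
      proof (cases "x \<in> e")
        case True
        then have "x = p \<or> x = q" using x rW(3) 1 by auto
        then show ?thesis using pW 1 inv q_def by auto
      qed (use x gW in blast)
    qed
    moreover have "s \<notin> W" using rW(3) 1 d e4 by auto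
    ultimately have "card V = 2"
      unfolding V_def using two_circles[OF assms(2,3) eg assms(5) pW(1) rW(4)] by blast
    with card_one 1 show ?thesis by blast
  next
    \<comment> \<open>The path joins the ends of one side of the edge and closes up with it, giving
      two boundary components. Colours alternating along the vertex circle then alternate along the
      sides as well.\<close>
    case 2
    have "g' ` W \<subseteq> W"
    proof clarify
      fix x assume x: "x \<in> W"
      show "g' x \<in> W"
      proof (cases "x \<in> e")
        case True
        then have "x = p \<or> x = s" using x rW(3) 2 by auto
        then show ?thesis using pW 2 inv s_def by auto
      qed (use x gW off in force)
    qed
    moreover have "q \<notin> W" using rW(3) 2 d e4 by auto
    ultimately have B: "card B = 2"
      unfolding B_def using two_circles[OF assms(2,4) eg' assms(5) pW(1) rW(4)] by blast
    obtain c :: "'a \<Rightarrow> bool" where c: "\<forall>x\<in>?u. c (f x) \<noteq> c x \<and> c (g x) \<noteq> c x"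
      using alternating_colouring[OF assms(1-3) u] by blast
    have eu: "e \<subseteq> ?u" and V: "V = {?u}" using one pr(1) 2 by (auto simp: V_def)
    have "c s \<noteq> c p" using rW(7)[OF c] 2 by simp
    moreover have "c q \<noteq> c p" "c t \<noteq> c s" using c eu p e4 gs q_def by blast+
    ultimately have "\<forall>x\<in>e. c (g' x) \<noteq> c x"
      unfolding e[symmetric] using inv s_def t_def by auto
    then have "orientable ?u" using c unfolding orientable_def by blast
    then show ?thesis using V eu B by blast
  next
    \<comment> \<open>The path joins opposite corners. An orientation would make the colours of
      \<open>p\<close> and \<open>t\<close> differ along the path, but agree along \<open>p\<close>,
      \<open>q\<close>, \<open>t\<close>, where the colour changes twice.\<close>
    case 3
    have eu: "e \<subseteq> ?u" and V: "V = {?u}" using one pr(1) 3 gs by (auto simp: V_def)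
    have "\<not> orientable ?u"
    proof
      assume "orientable ?u"
      then obtain c :: "'a \<Rightarrow> bool" where c: "\<forall>x\<in>?u. c (f x) \<noteq> c x \<and> c (g x) \<noteq> c x"
        "\<forall>x\<in>e. c (g' x) \<noteq> c x" unfolding orientable_def by blast
      have "c t \<noteq> c p" using rW(7)[OF c(1)] 3 by simp
      moreover have "c q \<noteq> c p" "c t \<noteq> c q" using c eu p e4 q_def t_def by blast+
      ultimately show False by auto
    qed
    then show ?thesis using V eu card_one 3 by blast
  qed
qed

section \<open>Components of the class graphs\<close>

text \<open>\<open>\<pi>\<close> maps each class onto a class, and each class is recovered as the
  preimage of its image; so \<open>\<pi>\<close> induces a bijection of the quotients.\<close>

lemma card_quotient_eq:
  assumes "\<pi> ` P = C" "E `` P \<subseteq> P" "F `` C \<subseteq> C"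
    and E: "\<And>p q. p \<in> P \<Longrightarrow> q \<in> P \<Longrightarrow> (p, q) \<in> E \<longleftrightarrow> (\<pi> p, \<pi> q) \<in> F"
  shows "card (C // F) = card (P // E)"
proof -
  have image: "\<pi> ` (E `` {p}) = F `` {\<pi> p}" if "p \<in> P" for p
  proof
    show "\<pi> ` (E `` {p}) \<subseteq> F `` {\<pi> p}" using that assms(2) E by auto
    show "F `` {\<pi> p} \<subseteq> \<pi> ` (E `` {p})"
    proof
      fix D assume "D \<in> F `` {\<pi> p}"
      then have "(\<pi> p, D) \<in> F" "D \<in> C" using that assms(1,3) by auto
      then obtain q where "q \<in> P" "D = \<pi> q" using assms(1) by auto
      then show "D \<in> \<pi> ` (E `` {p})" using that E \<open>(\<pi> p, D) \<in> F\<close> by auto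
    qed
  qed
  have "X = P \<inter> \<pi> -` (\<pi> ` X)" if X: "X \<in> P // E" for X
  proof -
    obtain p where p: "p \<in> P" "X = E `` {p}" using X by (auto elim: quotientE)
    then show ?thesis using image[OF p(1)] assms(2) E by auto
  qed
  then have "inj_on (image \<pi>) (P // E)" by (metis inj_onI)
  moreover have "image \<pi> ` (P // E) = C // F"
  proof -
    have "image \<pi> ` (P // E) = (\<lambda>p. \<pi> ` (E `` {p})) ` P" by (auto simp: quotient_def)
    also have "\<dots> = (\<lambda>p. F `` {\<pi> p}) ` P" by (rule image_cong[OF refl image])
    also have "\<dots> = (\<lambda>D. F `` {D}) ` (\<pi> ` P)" by (simp only: image_image)
    also have "\<dots> = C // F" unfolding assms(1) by (auto simp: quotient_def)
    finally show ?thesis .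
  qed
  ultimately show ?thesis using card_image by metis
qed

section \<open>Components of class graphs, computed on points\<close>

definition share :: "'a set set \<Rightarrow> ('a \<times> 'a) set" where
  "share \<S> = {(p, q). \<exists>S\<in>\<S>. p \<in> S \<and> q \<in> S}"

text \<open>Colour classes and edges alike act as hyperedges on the points. Since minors keep the
  point set but not the cells, this makes their component numbers comparable.\<close>

lemma num_components_points:
  assumes C: "partition_on X \<C>" and X: "partition_on P X" and A: "A \<subseteq> Pow P"
  shows "num_components \<C> A = card (P // (share (Union ` \<C> \<union> A))\<^sup>*)"
proof -
  let ?S = "share (Union ` \<C> \<union> A)" and ?F = "class_adjacency \<C> A"
  \<comment> \<open>\<open>\<pi>\<close> sends a point to the colour class of the cell that contains
    it.\<close>
  have "\<forall>p\<in>P. \<exists>C\<in>\<C>. p \<in> \<Union>C"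
    using partition_onD1[OF C] partition_onD1[OF X] by blast
  then obtain \<pi> where \<pi>: "\<And>p. p \<in> P \<Longrightarrow> \<pi> p \<in> \<C>" "\<And>p. p \<in> P \<Longrightarrow> p \<in> \<Union>(\<pi> p)"
    by metis
  have uniq: "\<pi> p = C" if "C \<in> \<C>" "p \<in> \<Union>C" for p C
  proof -
    obtain c where c: "c \<in> C" "p \<in> c" using \<open>p \<in> \<Union>C\<close> by auto
    have p: "p \<in> P" using that partition_onD1[OF C] partition_onD1[OF X] by blast
    obtain d where d: "d \<in> \<pi> p" "p \<in> d" using \<pi>(2)[OF p] by auto
    have "c \<in> X" "d \<in> X" using c d \<pi>(1)[OF p] that partition_onD1[OF C] by auto
    then have "c = d" using c d disjointD[OF partition_onD2[OF X]] by blast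
    then show ?thesis using c d \<pi>(1)[OF p] that disjointD[OF partition_onD2[OF C]] by blast
  qed
  have CP: "\<Union>C \<subseteq> P" if "C \<in> \<C>" for C
    using that partition_onD1[OF C] partition_onD1[OF X] by auto
  have SP: "q \<in> P" if "(p, q) \<in> ?S\<^sup>*" "p \<in> P" for p q
    using that CP A by (induction) (auto simp: share_def)
  have FC: "D \<in> \<C>" if "(C, D) \<in> ?F\<^sup>*" "C \<in> \<C>" for C D
    using that by (induction) (auto simp: class_adjacency_def)
  have to_classes: "(\<pi> p, \<pi> q) \<in> ?F\<^sup>*" if "(p, q) \<in> ?S\<^sup>*" "p \<in> P" for p q
    using that(1)
  proof induction
    case (step y z)
    have P: "y \<in> P" "z \<in> P" using SP step that(2) by (auto intro: rtrancl_into_rtrancl)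
    obtain S where S: "S \<in> Union ` \<C> \<union> A" "y \<in> S" "z \<in> S"
      using step(2) by (auto simp: share_def)
    show ?case
    proof (cases "S \<in> A")
      case True
      have "\<exists>c\<in>\<pi> y. meets c S" "\<exists>c\<in>\<pi> z. meets c S"
        using \<pi>(2)[OF P(1)] \<pi>(2)[OF P(2)] S(2,3) by (auto simp: meets_def)
      then have "(\<pi> y, \<pi> z) \<in> ?F"
        using True \<pi>(1)[OF P(1)] \<pi>(1)[OF P(2)] by (auto simp: class_adjacency_def)
      with step.IH show ?thesis by (rule rtrancl_into_rtrancl)
    next
      case False
      then obtain C where "C \<in> \<C>" "S = \<Union>C" using S(1) by auto
      then have "\<pi> y = \<pi> z" using uniq S(2,3) by metis
      with step.IH show ?thesis by simp
    qed
  qed simp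
  have to_points: "\<forall>p\<in>\<Union>C. \<forall>q\<in>\<Union>D. (p, q) \<in> ?S\<^sup>*" if "(C, D) \<in> ?F\<^sup>*" "C \<in> \<C>" for C D
    using that(1)
  proof induction
    case base
    then show ?case using that(2) by (auto simp: share_def intro!: r_into_rtrancl)
  next
    case (step D D')
    then obtain e x y where e: "e \<in> A" "x \<in> \<Union>D" "x \<in> e" "y \<in> \<Union>D'" "y \<in> e" "D' \<in> \<C>"
      by (auto simp: class_adjacency_def meets_def)
    have "(x, y) \<in> ?S" using e by (auto simp: share_def)
    moreover have "(y, q) \<in> ?S" if "q \<in> \<Union>D'" for q
      using that e by (auto simp: share_def)
    ultimately show ?case using step.IH e(2) by (meson rtrancl_into_rtrancl)
  qed
  show ?thesis
    unfolding num_components_def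
  proof (rule card_quotient_eq)
    show "\<pi> ` P = \<C>"
    proof
      show "\<C> \<subseteq> \<pi> ` P"
      proof
        fix C assume "C \<in> \<C>"
        then obtain p where "p \<in> \<Union>C"
          using partition_onD1[OF C] partition_onD3[OF C] partition_onD3[OF X]
          by (metis Union_iff ex_in_conv)
        then show "C \<in> \<pi> ` P" using uniq CP \<open>C \<in> \<C>\<close> by blast
      qed
    qed (use \<pi> in auto)
    show "?S\<^sup>* `` P \<subseteq> P" using SP by auto
    show "?F\<^sup>* `` \<C> \<subseteq> \<C>" using FC by auto
    show "(p, q) \<in> ?S\<^sup>* \<longleftrightarrow> (\<pi> p, \<pi> q) \<in> ?F\<^sup>*" if "p \<in> P" "q \<in> P" for p q
    proof
      show "(p, q) \<in> ?S\<^sup>* \<Longrightarrow> (\<pi> p, \<pi> q) \<in> ?F\<^sup>*" using that(1) by (rule to_classes[rotated])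
      show "(\<pi> p, \<pi> q) \<in> ?F\<^sup>* \<Longrightarrow> (p, q) \<in> ?S\<^sup>*"
        using to_points[OF _ \<pi>(1)[OF that(1)]] \<pi>(2)[OF that(1)] \<pi>(2)[OF that(2)] by blast
    qed
  qed
qed

lemma num_components_empty: "num_components \<C> {} = card \<C>"
proof -
  have "\<C> // Id = (\<lambda>C. {C}) ` \<C>" by (auto simp: quotient_def)
  moreover have "inj (\<lambda>C. {C})" by (rule injI) simp
  ultimately show ?thesis
    by (simp add: num_components_def class_adjacency_def card_image inj_on_subset)
qed

section \<open>Merging the classes met by an edge\<close>

lemma partition_on_replace_cells:
  assumes "partition_on X \<C>" "old \<subseteq> X" "new \<inter> (X - old) = {}" "new \<noteq> {}"
  shows "partition_on ((X - old) \<union> new) (replace_cells old new \<C>)"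
proof (rule partition_onI)
  show "\<Union>(replace_cells old new \<C>) = (X - old) \<union> new"
    using partition_onD1[OF assms(1)] by (auto simp: replace_cells_def)
next
  let ?T = "(\<Union>{C \<in> \<C>. C \<inter> old \<noteq> {}} - old) \<union> new"
  have dj: "C \<inter> D = {}" if "C \<in> \<C>" "D \<in> \<C>" "C \<noteq> D" for C D
    using disjointD[OF partition_onD2[OF assms(1)]] that by auto
  have T: "D \<inter> ?T = {}" if "D \<in> \<C>" "D \<inter> old = {}" for D
  proof -
    have "D \<inter> new = {}" using that assms(3) partition_onD1[OF assms(1)] by blast
    then show ?thesis using dj that by blast
  qed
  fix C D assume "C \<in> replace_cells old new \<C>" "D \<in> replace_cells old new \<C>" "C \<noteq> D"
  then consider "C \<in> \<C>" "D \<in> \<C>" "C \<noteq> D" | "C = ?T" "D \<in> \<C>" "D \<inter> old = {}"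
    | "D = ?T" "C \<in> \<C>" "C \<inter> old = {}"
    unfolding replace_cells_def by blast
  then show "disjnt C D"
    by cases (use dj T in \<open>simp_all only: disjnt_def Int_commute\<close>)
next
  show "{} \<notin> replace_cells old new \<C>"
    using partition_onD3[OF assms(1)] assms(4) by (auto simp: replace_cells_def)
qed

text \<open>All touched classes become one. It differs from every untouched class because it
  contains a new cell, and a new cell that is already in \<open>X\<close> belongs to
  \<open>old\<close>.\<close>

lemma card_replace_cells:
  assumes "partition_on X \<C>" "finite \<C>" "old \<subseteq> X" "new \<inter> (X - old) = {}" "new \<noteq> {}"
  shows "card (replace_cells old new \<C>) + card {C \<in> \<C>. C \<inter> old \<noteq> {}} = card \<C> + 1"
proof -
  let ?T = "(\<Union>{C \<in> \<C>. C \<inter> old \<noteq> {}} - old) \<union> new"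
  obtain c where c: "c \<in> new" using assms(5) by auto
  have "?T \<notin> {C \<in> \<C>. C \<inter> old = {}}"
  proof
    assume *: "?T \<in> {C \<in> \<C>. C \<inter> old = {}}"
    then have "c \<in> X" using partition_onD1[OF assms(1)] c by blast
    then have "c \<in> old" using c assms(4) by blast
    then show False using * c by blast
  qed
  then have "card (replace_cells old new \<C>) = Suc (card {C \<in> \<C>. C \<inter> old = {}})"
    using assms(2) by (simp add: replace_cells_def)
  moreover have "card {C \<in> \<C>. C \<inter> old = {}} + card {C \<in> \<C>. C \<inter> old \<noteq> {}} = card \<C>"
    using assms(2) by (subst card_Un_disjoint[symmetric]) (auto intro!: arg_cong[where f = card])
  ultimately show ?thesis by simp
qed

text \<open>The set difference by which \<open>delete\<close> and \<open>contract\<close> describe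
  the new cells is the set of cells of the minor that meet \<open>e\<close>.\<close>

lemma replace_cells_new:
  assumes "{c \<in> X. c \<inter> e = {}} = {c \<in> X'. c \<inter> e = {}}"
  shows "X' - (X - {c \<in> X. meets c e}) = {c \<in> X'. meets c e}"
    and "X' = (X - {c \<in> X. meets c e}) \<union> {c \<in> X'. meets c e}"
  using assms by (auto simp: meets_def)

text \<open>
  Merging the classes met by \<open>e\<close> amounts to joining them by the edge \<open>e\<close>: on the level of points,
  the merged class and the edge generate the same equivalence relation.
\<close>

lemma num_components_replace_cells:
  assumes X: "partition_on P X" and C: "partition_on X \<C>" and X': "partition_on P X'"
    and A: "A \<subseteq> Pow P" "e \<in> A" "e \<noteq> {}"
    and avoid: "{c \<in> X. c \<inter> e = {}} = {c \<in> X'. c \<inter> e = {}}"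
  shows "num_components (replace_cells {c \<in> X. meets c e} {c \<in> X'. meets c e} \<C>) (A - {e}) =
         num_components \<C> A"
proof -
  let ?old = "{c \<in> X. meets c e}" and ?new = "{c \<in> X'. meets c e}"
  let ?D = "replace_cells ?old ?new \<C>"
  let ?touch = "{C \<in> \<C>. C \<inter> ?old \<noteq> {}}"
  let ?T = "(\<Union>?touch - ?old) \<union> ?new"
  obtain x where x: "x \<in> e" "x \<in> P" using A by auto
  \<comment> \<open>The cells meeting \<open>e\<close> cover the complement of those avoiding it.
    The latter are common to \<open>X\<close> and \<open>X'\<close>, so old and new cells cover the
    same points.\<close>
  have Union_met: "\<Union>{c \<in> Y. meets c e} = P - \<Union>{c \<in> Y. c \<inter> e = {}}" if Y: "partition_on P Y" for Y
  proof -
    have "c \<inter> d = {}" if "c \<in> Y" "d \<in> Y" "meets c e" "d \<inter> e = {}" for c d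
      using that disjointD[OF partition_onD2[OF Y], of c d] by (auto simp: meets_def)
    then show ?thesis using partition_onD1[OF Y] by (auto simp: meets_def)
  qed
  have old_new: "\<Union>?old = \<Union>?new"
    unfolding Union_met[OF X] Union_met[OF X'] avoid ..
  have eold: "e \<subseteq> \<Union>?old"
    using partition_onD1[OF X] A by (auto simp: meets_def)
  have "?new \<noteq> {}" using old_new eold x by auto
  then have part: "partition_on X' ?D"
    using partition_on_replace_cells[OF C, of ?old ?new] replace_cells_new(2)[OF avoid] by auto
  have touch_old: "\<exists>C\<in>?touch. c \<in> C" if "c \<in> ?old" for c
    using that partition_onD1[OF C] by blast
  have old_touch: "\<Union>?old \<subseteq> \<Union>(\<Union>?touch)"
  proof
    fix y assume "y \<in> \<Union>?old"
    then obtain c where c: "c \<in> ?old" "y \<in> c" by (rule UnionE)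
    obtain C where "C \<in> ?touch" "c \<in> C" using touch_old[OF c(1)] by (rule bexE)
    then show "y \<in> \<Union>(\<Union>?touch)" using c(2) by (meson UnionI)
  qed
  have T: "\<Union>?T = \<Union>(\<Union>?touch)"
  proof
    show "\<Union>?T \<subseteq> \<Union>(\<Union>?touch)"
    proof
      fix y assume "y \<in> \<Union>?T"
      then have "y \<in> \<Union>(\<Union>?touch) \<or> y \<in> \<Union>?new" by blast
      then consider "y \<in> \<Union>(\<Union>?touch)" | "y \<in> \<Union>?old" unfolding old_new[symmetric] by argo
      then show "y \<in> \<Union>(\<Union>?touch)"
      proof cases
        case 2
        then show ?thesis using old_touch by (rule subsetD[rotated])
      qed
    qed
    show "\<Union>(\<Union>?touch) \<subseteq> \<Union>?T"
    proof
      fix y assume "y \<in> \<Union>(\<Union>?touch)"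
      then obtain c where c: "c \<in> \<Union>?touch" "y \<in> c" by blast
      show "y \<in> \<Union>?T"
      proof (cases "c \<in> ?old")
        case True
        then have "y \<in> \<Union>?new" using c unfolding old_new[symmetric] by blast
        then show ?thesis by blast
      qed (use c in blast)
    qed
  qed
  define M where "M = \<Union>?T"
  define untouched where "untouched = {C \<in> \<C>. C \<inter> ?old = {}}"
  have D: "Union ` ?D = insert M (Union ` untouched)"
    by (simp add: replace_cells_def M_def untouched_def)
  have eM: "e \<subseteq> M" unfolding M_def T using eold old_touch by (rule subset_trans)
  have CM: "\<Union>C \<subseteq> M" if "C \<in> ?touch" for C
    unfolding M_def T using that by (intro Union_mono Union_upper)
  have MC: "\<exists>C\<in>\<C>. p \<in> \<Union>C \<and> (\<exists>y\<in>\<Union>C. y \<in> e)" if pM: "p \<in> M" for p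
  proof -
    obtain C where C: "C \<in> ?touch" "p \<in> \<Union>C"
      using pM unfolding M_def T by (metis (no_types, lifting) Union_iff)
    then obtain c where "c \<in> C" "c \<inter> e \<noteq> {}" by (auto simp: meets_def)
    with C show ?thesis by blast
  qed
  have \<C>: "C \<in> untouched \<or> C \<in> ?touch" if "C \<in> \<C>" for C
    using that by (auto simp: untouched_def)
  have untouched: "untouched \<subseteq> \<C>" by (auto simp: untouched_def)
  let ?S = "share (Union ` \<C> \<union> A)" and ?S' = "share (insert M (Union ` untouched) \<union> (A - {e}))"
  have "?S \<subseteq> ?S'"
  proof clarify
    fix p q assume "(p, q) \<in> ?S"
    then obtain S where S: "S \<in> Union ` \<C> \<union> A" "p \<in> S" "q \<in> S" by (auto simp: share_def)
    have "\<exists>S'\<in>insert M (Union ` untouched) \<union> (A - {e}). S \<subseteq> S'"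
    proof (cases "S \<in> A")
      case True
      then show ?thesis using eM by (cases "S = e") auto
    next
      case False
      then obtain C where C: "C \<in> \<C>" "S = \<Union>C" using S(1) by auto
      from \<C>[OF C(1)] show ?thesis
      proof
        assume "C \<in> ?touch"
        from CM[OF this] C(2) show ?thesis by auto
      qed (use C(2) in auto)
    qed
    then obtain S' where S': "S' \<in> insert M (Union ` untouched) \<union> (A - {e})" "S \<subseteq> S'" ..
    show "(p, q) \<in> ?S'"
      unfolding share_def using S' S(2,3) by (intro CollectI case_prodI bexI[OF _ S'(1)] conjI) auto
  qed
  moreover have "?S' \<subseteq> ?S\<^sup>*"
  proof clarify
    fix p q assume "(p, q) \<in> ?S'"
    then obtain S where S: "S \<in> insert M (Union ` untouched) \<union> (A - {e})" "p \<in> S" "q \<in> S"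
      by (auto simp: share_def)
    then consider "S \<in> Union ` \<C> \<union> A" | "S = M" using untouched by blast
    then show "(p, q) \<in> ?S\<^sup>*"
    proof cases
      case 1
      then have "(p, q) \<in> ?S" using S(2,3) unfolding share_def by blast
      then show ?thesis by (rule r_into_rtrancl)
    next
      case 2
      then have pq: "p \<in> M" "q \<in> M" using S(2,3) by auto
      \<comment> \<open>Two points of the merged class are linked by three steps: inside a touched
        class to a point of \<open>e\<close>, along \<open>e\<close>, and inside another touched
        class.\<close>
      obtain C1 y where 1: "C1 \<in> \<C>" "p \<in> \<Union>C1" "y \<in> \<Union>C1" "y \<in> e" using MC[OF pq(1)] by blast
      obtain C2 z where 2: "C2 \<in> \<C>" "q \<in> \<Union>C2" "z \<in> \<Union>C2" "z \<in> e" using MC[OF pq(2)] by blast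
      have "(p, y) \<in> ?S" "(y, z) \<in> ?S" "(z, q) \<in> ?S"
        using 1 2 A(2) unfolding share_def by blast+
      then show ?thesis by (rule rtrancl_into_rtrancl[OF rtrancl_into_rtrancl[OF r_into_rtrancl]])
    qed
  qed
  ultimately have "?S'\<^sup>* = ?S\<^sup>*"
    by (rule rtrancl_subset)
  then show "num_components ?D (A - {e}) = num_components \<C> A"
    using num_components_points[OF part X', of "A - {e}"] num_components_points[OF C X A(1)] A(1)
    unfolding D by auto
qed

text \<open>Taking \<open>X' = X\<close> in the merging lemma leaves the cells alone and turns the
  only edge into a merge of the classes it meets; what remains is to count classes.\<close>

lemma num_components_single:
  assumes "partition_on P X" "partition_on X \<C>" "finite \<C>" "e \<subseteq> P" "e \<noteq> {}"
  shows "num_components \<C> {e} + card {C \<in> \<C>. C \<inter> {c \<in> X. meets c e} \<noteq> {}} = card \<C> + 1"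
proof -
  let ?old = "{c \<in> X. meets c e}"
  have "num_components \<C> {e} = card (replace_cells ?old ?old \<C>)"
    using num_components_replace_cells[OF assms(1,2,1), of "{e}" e] assms(4,5)
    by (simp add: num_components_empty)
  moreover have "?old \<noteq> {}"
    using assms(4,5) partition_onD1[OF assms(1)] by (auto simp: meets_def)
  ultimately show ?thesis using card_replace_cells[OF assms(2,3), of ?old ?old] by auto
qed

section \<open>Deletion and contraction\<close>

text \<open>The second arc system along the boundary of the ribbon subgraph with edge set
  \<open>A\<close>. The empty set gives the vertices and the full edge set the boundary components,
  so both are treated together.\<close>

definition boundary_arc :: "('p, 'm) ribbon_scheme \<Rightarrow> 'p set set \<Rightarrow> 'p \<Rightarrow> 'p" where
  "boundary_arc G A = (\<lambda>p. if p \<in> \<Union>A then edge_side G p else line_seg G p)"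

lemma boundaries_arc: "boundaries G = circles (points G) (free_arc G) (boundary_arc G (edges G))"
  by (simp add: boundaries_def boundary_arc_def)

lemma vertices_arc: "vertices G = circles (points G) (free_arc G) (boundary_arc G {})"
  by (simp add: vertices_def boundary_arc_def)

lemma num_boundaries_arc:
  "num_boundaries G A = card (circles (points G) (free_arc G) (boundary_arc G A))"
  by (simp add: num_boundaries_def boundaries_def boundary_arc_def cong: if_cong)

text \<open>Segments and sides both preserve the point set of each edge, so switching from one to
  the other on \<open>A\<close> is consistent.\<close>

lemma boundary_arc_involution:
  assumes "ribbon_graph G" "A \<subseteq> edges G"
  shows "fpf_involution_on (points G) (boundary_arc G A)"
proof -
  have e: "e \<subseteq> points G" "fpf_involution_on e (line_seg G)" "fpf_involution_on e (edge_side G)"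
    if "e \<in> A" for e
    using assms that by (auto simp: ribbon_graph_def)
  show ?thesis
    unfolding fpf_involution_on_def
  proof
    fix p assume p: "p \<in> points G"
    have line: "line_seg G p \<in> points G" "line_seg G p \<noteq> p" "line_seg G (line_seg G p) = p"
      using assms(1) p by (auto simp: ribbon_graph_def fpf_involution_on_def)
    show "boundary_arc G A p \<in> points G \<and> boundary_arc G A p \<noteq> p \<and>
      boundary_arc G A (boundary_arc G A p) = p"
    proof (cases "p \<in> \<Union>A")
      case True
      then obtain d where d: "d \<in> A" "p \<in> d" by blast
      note fpf_involution_onD[OF e(3)[OF d(1)] d(2)]
      moreover from this have "edge_side G p \<in> \<Union>A" using d by blast
      ultimately show ?thesis
        using True e(1)[OF d(1)] by (auto simp: boundary_arc_def)
    next
      case False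
      have "line_seg G p \<notin> \<Union>A"
      proof
        assume "line_seg G p \<in> \<Union>A"
        then obtain d where d: "d \<in> A" "line_seg G p \<in> d" by blast
        then have "p \<in> d" using fpf_involution_onD(1)[OF e(2)[OF d(1)] d(2)] line(3) by simp
        then show False using False d by blast
      qed
      then show ?thesis using False line by (simp add: boundary_arc_def)
    qed
  qed
qed

lemma free_arc_involution:
  "ribbon_graph G \<Longrightarrow> fpf_involution_on (points G) (free_arc G)"
  by (simp add: ribbon_graph_def)

lemma partition_on_boundary_circles:
  assumes "ribbon_graph G" "A \<subseteq> edges G"
  shows "partition_on (points G) (circles (points G) (free_arc G) (boundary_arc G A))"
  using assms by (intro partition_on_circles free_arc_involution boundary_arc_involution)

lemma edge_properties:
  assumes "ribbon_graph G" "e \<in> edges G"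
  shows "e \<subseteq> points G" "e \<noteq> {}" "card e = 4"
  using assms by (auto simp: ribbon_graph_def)

lemma finite_edges: "ribbon_graph G \<Longrightarrow> finite (edges G)"
  by (rule finite_subset[of _ "Pow (points G)"]) (auto simp: ribbon_graph_def)

lemma delete_simps [simp]:
  "points (delete e G) = points G" "free_arc (delete e G) = free_arc G"
  "line_seg (delete e G) = line_seg G" "edge_side (delete e G) = edge_side G"
  "edges (delete e G) = edges G - {e}" "vertex_classes (delete e G) = vertex_classes G"
  by (simp_all add: delete_def delete_edge_def Let_def)

lemma contract_simps [simp]:
  "points (contract e G) = points G" "free_arc (contract e G) = free_arc G"
  "edge_side (contract e G) = edge_side G"
  "line_seg (contract e G) = boundary_arc G {e}"
  "edges (contract e G) = edges G - {e}" "boundary_classes (contract e G) = boundary_classes G"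
  by (simp_all add: contract_def contract_edge_def Let_def boundary_arc_def)

lemma boundary_arc_delete [simp]: "boundary_arc (delete e G) A = boundary_arc G A"
  by (simp add: boundary_arc_def cong: if_cong)

lemma boundary_arc_contract [simp]: "boundary_arc (contract e G) A = boundary_arc G (insert e A)"
  by (auto simp: boundary_arc_def)

lemma num_boundaries_delete: "num_boundaries (delete e G) A = num_boundaries G A"
  by (simp add: num_boundaries_arc)

lemma num_boundaries_contract: "num_boundaries (contract e G) A = num_boundaries G (insert e A)"
  by (simp add: num_boundaries_arc)

lemma circles_avoiding_edge:
  assumes "ribbon_graph G" "A \<subseteq> edges G" "B \<subseteq> edges G" "A - {e} = B - {e}"
  shows "{c \<in> circles (points G) (free_arc G) (boundary_arc G A). c \<inter> e = {}} =
    {c \<in> circles (points G) (free_arc G) (boundary_arc G B). c \<inter> e = {}}"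
proof (rule circles_avoiding)
  show "boundary_arc G B p = boundary_arc G A p" if "p \<in> points G - e" for p
  proof -
    have "p \<in> \<Union>A \<longleftrightarrow> p \<in> \<Union>(A - {e})" "p \<in> \<Union>B \<longleftrightarrow> p \<in> \<Union>(B - {e})" using that by auto
    then show ?thesis using assms(4) by (simp add: boundary_arc_def)
  qed
qed (rule free_arc_involution boundary_arc_involution assms)+

text \<open>Since \<open>e\<close> lies in the complement of \<open>A\<close>, it is an edge of the
  graph on boundary classes; deleting it merges the classes that it joined there.\<close>

lemma num_components_delete:
  assumes "coloured_ribbon_graph G" "e \<in> edges G" "e \<notin> A"
  shows "num_components (boundary_classes (delete e G)) (edges G - {e} - A) =
    num_components (boundary_classes G) (edges G - A)"
proof -
  let ?circles = "\<lambda>A. circles (points G) (free_arc G) (boundary_arc G A)"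
  have G: "ribbon_graph G" using assms by (simp add: coloured_ribbon_graph_def)
  let ?X = "?circles (edges G)" and ?X' = "?circles (edges G - {e})"
  have avoid: "{c \<in> ?X. c \<inter> e = {}} = {c \<in> ?X'. c \<inter> e = {}}"
    by (rule circles_avoiding_edge[OF G]) auto
  have "boundary_classes (delete e G) =
    replace_cells {c \<in> ?X. meets c e} {c \<in> ?X'. meets c e} (boundary_classes G)"
    unfolding replace_cells_new(1)[OF avoid, symmetric]
    by (simp add: delete_def Let_def delete_edge_def boundaries_arc boundary_arc_def cong: if_cong)
  then have "num_components (boundary_classes (delete e G)) (edges G - A - {e}) =
      num_components (boundary_classes G) (edges G - A)"
    using num_components_replace_cells
        [OF _ _ _ _ _ _ avoid, of "points G" "boundary_classes G" "edges G - A"]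
      partition_on_boundary_circles[OF G] assms edge_properties[OF G]
    by (auto simp: coloured_ribbon_graph_def boundaries_arc)
  moreover have "edges G - {e} - A = edges G - A - {e}" by auto
  ultimately show ?thesis by simp
qed

text \<open>The dual situation: contraction passes from the circles of \<open>{}\<close> to those of
  \<open>{e}\<close> and merges the vertex classes joined by \<open>e\<close>.\<close>

lemma num_components_contract:
  assumes "coloured_ribbon_graph G" "e \<in> edges G" "e \<notin> A" "A \<subseteq> edges G"
  shows "num_components (vertex_classes (contract e G)) A =
    num_components (vertex_classes G) (insert e A)"
proof -
  let ?circles = "\<lambda>A. circles (points G) (free_arc G) (boundary_arc G A)"
  have G: "ribbon_graph G" using assms by (simp add: coloured_ribbon_graph_def)
  let ?X = "?circles {}" and ?X' = "?circles {e}"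
  have avoid: "{c \<in> ?X. c \<inter> e = {}} = {c \<in> ?X'. c \<inter> e = {}}"
    by (rule circles_avoiding_edge[OF G]) (use assms in auto)
  have "vertex_classes (contract e G) =
    replace_cells {c \<in> ?X. meets c e} {c \<in> ?X'. meets c e} (vertex_classes G)"
    unfolding replace_cells_new(1)[OF avoid, symmetric]
    by (simp add: contract_def Let_def contract_edge_def vertices_arc boundary_arc_def cong: if_cong)
  moreover have "num_components (replace_cells {c \<in> ?X. meets c e} {c \<in> ?X'. meets c e} (vertex_classes G))
      (insert e A - {e}) = num_components (vertex_classes G) (insert e A)"
    by (rule num_components_replace_cells[OF _ _ _ _ _ _ avoid, of "points G"])
      (use partition_on_boundary_circles[OF G] assms edge_properties[OF G] in
       \<open>auto simp: coloured_ribbon_graph_def vertices_arc\<close>)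
  ultimately show ?thesis using assms(3) by simp
qed

section \<open>Graphs with a single edge\<close>

lemma circles_remove:
  assumes "fpf_involution_on P f" "fpf_involution_on P g" "I \<subseteq> circles P f g"
  shows "circles (P - \<Union>I) f g = circles P f g - I"
proof
  show "circles (P - \<Union>I) f g \<subseteq> circles P f g - I"
    by (auto simp: circles_arcs quotient_def)
  show "circles P f g - I \<subseteq> circles (P - \<Union>I) f g"
  proof
    fix c assume c: "c \<in> circles P f g - I"
    then obtain p where p: "p \<in> P" "c = (arcs f g)\<^sup>* `` {p}"
      by (auto simp: circles_arcs elim: quotientE)
    have "p \<notin> \<Union>I"
    proof
      assume "p \<in> \<Union>I"
      then obtain d where "d \<in> I" "p \<in> d" by blast
      then have "d = c" using circle_eq[OF assms(1,2), of d p] assms(3) p(2) by auto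
      then show False using c \<open>d \<in> I\<close> by blast
    qed
    with p show "c \<in> circles (P - \<Union>I) f g" by (auto simp: circles_arcs quotientI)
  qed
qed

lemma same_class_remove:
  assumes "a \<notin> I" "b \<notin> I"
  shows "same_class ((\<lambda>C. C - I) ` \<C> - {{}}) a b \<longleftrightarrow> same_class \<C> a b"
proof
  assume "same_class \<C> a b"
  then obtain C where "C \<in> \<C>" "a \<in> C - I" "b \<in> C - I" using assms by (auto simp: same_class_def)
  then show "same_class ((\<lambda>C. C - I) ` \<C> - {{}}) a b"
    unfolding same_class_def by (intro bexI[of _ "C - I"]) auto
qed (auto simp: same_class_def)

text \<open>The case \<open>a = b\<close> is included and covers an edge that meets a single
  cell.\<close>

lemma card_touched_classes:
  assumes "partition_on X \<C>" "a \<in> X" "b \<in> X"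
  shows "card {C \<in> \<C>. C \<inter> {a, b} \<noteq> {}} = (if same_class \<C> a b then 1 else 2)"
proof -
  have "a \<in> \<Union>\<C>" "b \<in> \<Union>\<C>" using assms(2,3) partition_onD1[OF assms(1)] by simp_all
  then obtain C D where CD: "C \<in> \<C>" "a \<in> C" "D \<in> \<C>" "b \<in> D" by blast
  have u: "C' = D'" if "C' \<in> \<C>" "D' \<in> \<C>" "x \<in> C'" "x \<in> D'" for C' D' x
    using that disjointD[OF partition_onD2[OF assms(1)]] by blast
  have "{C \<in> \<C>. C \<inter> {a, b} \<noteq> {}} = {C, D}"
    using CD u by blast
  moreover have "same_class \<C> a b \<longleftrightarrow> C = D"
    using CD u unfolding same_class_def by metis
  ultimately show ?thesis by (auto simp: card_insert_if)
qed

text \<open>Vertices and boundary components that avoid the only edge are the same circles, so one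
  set \<open>I\<close> is removed from both partitions.\<close>

lemma remove_isolated_single:
  assumes "coloured_ribbon_graph H" "edges H = {e}"
  defines "I \<equiv> {u \<in> vertices H. \<not> meets u e}"
  shows "vertices (remove_isolated H) = {u \<in> vertices H. meets u e}"
    and "boundaries (remove_isolated H) = {b \<in> boundaries H. meets b e}"
    and "I = {b \<in> boundaries H. \<not> meets b e}"
    and "remove_isolated H = H\<lparr>points := points H - \<Union>I,
           vertex_classes := (\<lambda>C. C - I) ` vertex_classes H - {{}},
           boundary_classes := (\<lambda>B. B - I) ` boundary_classes H - {{}}\<rparr>"
proof -
  have H: "ribbon_graph H" using assms by (simp add: coloured_ribbon_graph_def)
  note inv = free_arc_involution[OF H] boundary_arc_involution[OF H]
  show K: "remove_isolated H = H\<lparr>points := points H - \<Union>I,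
           vertex_classes := (\<lambda>C. C - I) ` vertex_classes H - {{}},
           boundary_classes := (\<lambda>B. B - I) ` boundary_classes H - {{}}\<rparr>"
    by (simp add: remove_isolated_def Let_def assms(2) I_def)
  have arc: "boundary_arc (remove_isolated H) A = boundary_arc H A" for A
    by (simp add: boundary_arc_def K cong: if_cong)
  have I: "I \<subseteq> circles (points H) (free_arc H) (boundary_arc H {})"
    by (auto simp: I_def vertices_arc)
  show I': "I = {b \<in> boundaries H. \<not> meets b e}"
    using circles_avoiding_edge[OF H, of "{}" "{e}" e] assms(2)
    by (simp add: I_def vertices_arc boundaries_arc meets_def)
  then have "I \<subseteq> circles (points H) (free_arc H) (boundary_arc H {e})"
    by (auto simp: boundaries_arc assms(2))
  then have "circles (points H - \<Union>I) (free_arc H) (boundary_arc H {e}) =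
      circles (points H) (free_arc H) (boundary_arc H {e}) - I"
    using inv assms(2) by (intro circles_remove) auto
  then have "boundaries (remove_isolated H) = boundaries H - I"
    unfolding boundaries_arc arc by (simp add: K assms(2))
  then show "boundaries (remove_isolated H) = {b \<in> boundaries H. meets b e}"
    unfolding I' by auto
  have "circles (points H - \<Union>I) (free_arc H) (boundary_arc H {}) =
      circles (points H) (free_arc H) (boundary_arc H {}) - I"
    using inv I by (intro circles_remove) auto
  then have "vertices (remove_isolated H) = vertices H - I"
    unfolding vertices_arc arc by (simp add: K)
  then show "vertices (remove_isolated H) = {u \<in> vertices H. meets u e}"
    by (auto simp: I_def)
qed

text \<open>
  The numbers of vertices, boundary components, vertex classes and boundary classes of a graph that
  consists of a single edge and its ends.
\<close>

fun edge_numbers :: "edge_type \<Rightarrow> nat \<times> nat \<times> nat \<times> nat" where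
  "edge_numbers BS = (2, 1, 2, 1)"
| "edge_numbers BP = (2, 1, 1, 1)"
| "edge_numbers OLC = (1, 2, 1, 2)"
| "edge_numbers OLH = (1, 2, 1, 1)"
| "edge_numbers NL = (1, 1, 1, 1)"

text \<open>The numbers count only cells of \<open>H\<close> that meet \<open>e\<close> and the
  classes touched by them. Removing isolated vertices preserves these cells and whether two of them
  share a class, so the type can be compared with counts in \<open>H\<close> itself.\<close>

lemma single_edge_type:
  fixes H :: "'p coloured_ribbon"
  assumes H: "coloured_ribbon_graph H" "edges H = {e}"
  defines "V \<equiv> {u \<in> vertices H. meets u e}" and "B \<equiv> {b \<in> boundaries H. meets b e}"
  defines "m \<equiv> card {C \<in> vertex_classes H. C \<inter> V \<noteq> {}}"
    and "n \<equiv> card {C \<in> boundary_classes H. C \<inter> B \<noteq> {}}"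
  shows "\<exists>\<tau>. is_single_edge \<tau> (remove_isolated H)"
    and "is_single_edge \<tau> (remove_isolated H) \<Longrightarrow> edge_numbers \<tau> = (card V, card B, m, n)"
proof -
  let ?K = "remove_isolated H"
  define I where "I = {u \<in> vertices H. \<not> meets u e}"
  have G: "ribbon_graph H" using H by (simp add: coloured_ribbon_graph_def)
  note K = remove_isolated_single(4)[OF H, folded I_def]
  note VK = remove_isolated_single(1)[OF H, folded V_def]
  note BK = remove_isolated_single(2)[OF H, folded B_def]
  have partV: "partition_on (vertices H) (vertex_classes H)"
    and partB: "partition_on (boundaries H) (boundary_classes H)"
    using H by (auto simp: coloured_ribbon_graph_def)
  have sV: "same_class (vertex_classes ?K) u v \<longleftrightarrow> same_class (vertex_classes H) u v"
    if "u \<in> V" "v \<in> V" for u v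
    using that same_class_remove[of u I v] by (simp add: K I_def V_def)
  have sB: "same_class (boundary_classes ?K) u v \<longleftrightarrow> same_class (boundary_classes H) u v"
    if "u \<in> B" "v \<in> B" for u v
    using that same_class_remove[of u I v] remove_isolated_single(3)[OF H]
    by (simp add: K I_def B_def)
  have m: "m = (if same_class (vertex_classes ?K) u v then 1 else 2)" if V: "V = {u, v}" for u v
  proof -
    have "u \<in> V" "v \<in> V" using V by auto
    then show ?thesis
      unfolding m_def V sV[OF \<open>u \<in> V\<close> \<open>v \<in> V\<close>]
      by (intro card_touched_classes[OF partV]) (use \<open>u \<in> V\<close> \<open>v \<in> V\<close> in \<open>simp_all add: V_def\<close>)
  qed
  have n: "n = (if same_class (boundary_classes ?K) u v then 1 else 2)" if B: "B = {u, v}" for u v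
  proof -
    have "u \<in> B" "v \<in> B" using B by auto
    then show ?thesis
      unfolding n_def B sB[OF \<open>u \<in> B\<close> \<open>v \<in> B\<close>]
      by (intro card_touched_classes[OF partB]) (use \<open>u \<in> B\<close> \<open>v \<in> B\<close> in \<open>simp_all add: B_def\<close>)
  qed
  have self: "same_class (vertex_classes ?K) u u" if "u \<in> V" for u
    unfolding sV[OF that that] using that partition_onD1[OF partV]
    by (auto simp: same_class_def V_def)
  have self': "same_class (boundary_classes ?K) u u" if "u \<in> B" for u
    unfolding sB[OF that that] using that partition_onD1[OF partB]
    by (auto simp: same_class_def B_def)
  have m1: "m = 1" if "card V = 1" 
    using that m self by (metis card_1_singletonE insert_absorb2 insertI1)
  have n1: "n = 1" if "card B = 1"
    using that n self' by (metis card_1_singletonE insert_absorb2 insertI1)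
  have orient: "orientable_union ?K u e \<longleftrightarrow> orientable_union H u e" for u
    by (simp add: orientable_union_def K)
  have eK: "edges ?K = {e}" by (simp add: K H)
  have edge: "e \<subseteq> points H" "card e = 4" "fpf_involution_on e (line_seg H)"
      "fpf_involution_on e (edge_side H)" "\<And>x. x \<in> e \<Longrightarrow> line_seg H x \<noteq> edge_side H x"
    using G H(2) by (auto simp: ribbon_graph_def)
  have line: "boundary_arc H {} = line_seg H" by (simp add: boundary_arc_def)
  have "card V = 2 \<and> card B = 1 \<or>
    (\<exists>u. V = {u} \<and> e \<subseteq> u \<and>
         (card B = 2 \<and> orientable_union H u e \<or> card B = 1 \<and> \<not> orientable_union H u e))"
  proof -
    have "fpf_involution_on e (boundary_arc H {e})"
      using edge(4) by (auto simp: fpf_involution_on_def boundary_arc_def)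
    moreover have "orientable_union H u e \<longleftrightarrow>
        (\<exists>s :: 'p \<Rightarrow> bool. (\<forall>x\<in>u. s (free_arc H x) \<noteq> s x \<and> s (line_seg H x) \<noteq> s x) \<and>
           (\<forall>x\<in>e. s (boundary_arc H {e} x) \<noteq> s x))" for u
      by (simp add: orientable_union_def boundary_arc_def)
    moreover have "boundary_arc H {e} x = (if x \<in> e then edge_side H x else line_seg H x)" for x
      by (simp add: boundary_arc_def)
    moreover have "finite (points H)" "fpf_involution_on (points H) (line_seg H)"
      using G by (auto simp: ribbon_graph_def)
    ultimately show ?thesis
      using attached_edge_cases[of "points H" "free_arc H" "line_seg H" "boundary_arc H {e}" e]
        free_arc_involution[OF G] boundary_arc_involution[OF G, of "{e}"] edge H(2)
      by (simp add: V_def B_def boundaries_arc vertices_arc line)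
  qed
  then consider (nonloop) "card V = 2" "card B = 1"
    | (orientable) u where "V = {u}" "card B = 2" "orientable_loop ?K e" "\<not> non_orientable_loop ?K e"
    | (nonorientable) u where "V = {u}" "card B = 1" "\<not> orientable_loop ?K e" "non_orientable_loop ?K e"
    by (auto simp: orientable_loop_def non_orientable_loop_def VK orient)
  note cases = this
  have B1: "card B = 1" if "card V = 2 \<or> non_orientable_loop ?K e"
    using that by (cases rule: cases) auto
  show "\<exists>\<tau>. is_single_edge \<tau> ?K"
  proof (cases rule: cases)
    case nonloop
    then obtain u v where uv: "V = {u, v}" "u \<noteq> v" by (auto simp: card_2_iff)
    then have "meets u e" "meets v e" by (auto simp: V_def)
    note uv = uv this
    have "is_single_edge BP ?K" if "same_class (vertex_classes ?K) u v"
      unfolding is_single_edge.simps eK VK by (intro exI conjI) (rule refl uv that)+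
    moreover have "is_single_edge BS ?K" if "\<not> same_class (vertex_classes ?K) u v"
      unfolding is_single_edge.simps eK VK
      by (intro exI conjI) (rule refl uv that)+
    ultimately show ?thesis by blast
  next
    case (orientable u)
    then obtain a b where ab: "B = {a, b}" "a \<noteq> b" by (auto simp: card_2_iff)
    have "is_single_edge OLH ?K" if "same_class (boundary_classes ?K) a b"
      unfolding is_single_edge.simps eK VK BK
      by (intro exI conjI) (rule refl ab that orientable)+
    moreover have "is_single_edge OLC ?K" if "\<not> same_class (boundary_classes ?K) a b"
      unfolding is_single_edge.simps eK VK BK
      by (intro exI conjI) (rule refl ab that orientable)+
    ultimately show ?thesis by blast
  next
    case (nonorientable u)
    have "is_single_edge NL ?K"
      unfolding is_single_edge.simps eK VK by (intro exI conjI) (rule refl nonorientable)+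
    then show ?thesis ..
  qed
  show "edge_numbers \<tau> = (card V, card B, m, n)" if \<tau>: "is_single_edge \<tau> ?K"
  proof (cases \<tau>)
    case BS
    obtain u v where "V = {u, v}" "u \<noteq> v" "\<not> same_class (vertex_classes ?K) u v"
      using \<tau> unfolding BS is_single_edge.simps eK VK BK by blast
    then have "card V = 2" "m = 2" using m by auto
    moreover from this have "card B = 1" using B1 by blast
    ultimately show ?thesis using BS n1 by simp
  next
    case BP
    obtain u v where "V = {u, v}" "u \<noteq> v" "same_class (vertex_classes ?K) u v"
      using \<tau> unfolding BP is_single_edge.simps eK VK BK by blast
    then have "card V = 2" "m = 1" using m by auto
    moreover from this have "card B = 1" using B1 by blast
    ultimately show ?thesis using BP n1 by simp
  next
    case OLC
    obtain u a b where "V = {u}" "B = {a, b}" "a \<noteq> b" "\<not> same_class (boundary_classes ?K) a b"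
      using \<tau> unfolding OLC is_single_edge.simps eK VK BK by blast
    then have "card V = 1" "card B = 2" "n = 2" using n by auto
    then show ?thesis using OLC m1 by simp
  next
    case OLH
    obtain u a b where "V = {u}" "B = {a, b}" "a \<noteq> b" "same_class (boundary_classes ?K) a b"
      using \<tau> unfolding OLH is_single_edge.simps eK VK BK by blast
    then have "card V = 1" "card B = 2" "n = 1" using n by auto
    then show ?thesis using OLH m1 by simp
  next
    case NL
    obtain u where "V = {u}" "non_orientable_loop ?K e"
      using \<tau> unfolding NL is_single_edge.simps eK VK by (metis singleton_inject)
    moreover from this have "card B = 1" using B1 by blast
    ultimately show ?thesis using NL m1 n1 by simp
  qed
qed

section \<open>Weights\<close>

text \<open>
  Up to a factor that depends only on the graph, the weight of \<open>A\<close> is the monomial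
  \<open>x\<^bsup>r1\<^esup> s\<^bsup>2 r2\<^esup> y\<^bsup>r3\<^esup> t\<^bsup>2 r4\<^esup>\<close> in the rank parameters of \<open>A\<close>.  Only quotients of weights matter, and in
  this form a weight is preserved by deletion.
\<close>

definition weight :: "'a :: field \<Rightarrow> 'a \<Rightarrow> 'a \<Rightarrow> 'a \<Rightarrow> 'p coloured_ribbon \<Rightarrow> 'p set set \<Rightarrow> 'a" where
  "weight x s y t G A =
     (let k = int (num_components (vertex_classes G) A);
          l = int (num_components (boundary_classes G) (edges G - A));
          b = int (num_boundaries G A); n = int (card A)
      in x powi (- k) * s powi (n - b + 2 * k) * y powi l * t powi (n + b - 2 * l))"

lemma weight_nonzero:
  assumes "x \<noteq> 0" "s \<noteq> 0" "y \<noteq> 0" "t \<noteq> 0"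
  shows "weight x s y t G A \<noteq> 0"
  using assms by (simp add: weight_def Let_def)

lemma weight_delete:
  assumes "coloured_ribbon_graph G" "e \<in> edges G" "e \<notin> A"
  shows "weight x s y t (delete e G) A = weight x s y t G A"
  by (simp add: weight_def num_boundaries_delete num_components_delete[OF assms])

text \<open>The component and boundary numbers are unchanged, while the cardinality drops by one. It
  enters the exponents of \<open>s\<close> and \<open>t\<close> once each, whence the factor
  \<open>s * t\<close>.\<close>

lemma weight_contract:
  assumes G: "coloured_ribbon_graph G" "e \<in> edges G" "e \<notin> A" "A \<subseteq> edges G"
    and "s \<noteq> 0" "t \<noteq> 0"
  shows "weight x s y t G (insert e A) = s * t * weight x s y t (contract e G) A"
proof -
  have "finite A" using G finite_edges by (metis coloured_ribbon_graph_def finite_subset)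
  then have "int (card (insert e A)) = int (card A) + 1" using assms(3) by simp
  moreover have "edges G - insert e A = edges G - {e} - A" by auto
  moreover have "s powi (n + 1 - b + k) = s * s powi (n - b + k)" for n b k
    using power_int_add[of s 1 "n - b + k"] assms(5) by (simp add: algebra_simps)
  moreover have "t powi (n + 1 + b - k) = t * t powi (n + b - k)" for n b k
    using power_int_add[of t 1 "n + b - k"] assms(6) by (simp add: algebra_simps)
  ultimately show ?thesis
    by (simp add: weight_def Let_def num_boundaries_contract num_components_contract[OF G] mult_ac)
qed

text \<open>A common form of \<open>coeff_a\<close> and \<open>coeff_b\<close>, with
  \<open>s\<close> and \<open>t\<close> in the place of the chosen square roots.\<close>

fun type_weight :: "'a :: field \<Rightarrow> 'a \<Rightarrow> 'a \<Rightarrow> 'a \<Rightarrow> edge_type \<Rightarrow> 'a" where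
  "type_weight x s y t BS = x"
| "type_weight x s y t BP = s ^ 2"
| "type_weight x s y t OLC = y"
| "type_weight x s y t OLH = t ^ 2"
| "type_weight x s y t NL = s * t"

lemma coeff_type_weight:
  "coeff_a \<tau> = type_weight a_bs sqrt_a_bp a_olc sqrt_a_olh \<tau>"
  "coeff_b \<tau> = type_weight b_bs sqrt_b_bp b_olc sqrt_b_olh \<tau>"
  by (cases \<tau>; simp)+

text \<open>Adding the only edge changes the exponents by amounts that depend only on its
  \<open>edge_numbers\<close>, which the type determines.\<close>

lemma weight_single:
  assumes H: "coloured_ribbon_graph H" "edges H = {e}" and \<tau>: "is_single_edge \<tau> (remove_isolated H)"
    and nz: "x \<noteq> 0" "s \<noteq> 0" "y \<noteq> 0" "t \<noteq> 0"
  shows "weight x s y t H {e} = type_weight x s y t \<tau> * weight x s y t H {}"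
proof -
  define V where "V = {u \<in> vertices H. meets u e}"
  define B where "B = {b \<in> boundaries H. meets b e}"
  define m where "m = card {C \<in> vertex_classes H. C \<inter> V \<noteq> {}}"
  define n where "n = card {C \<in> boundary_classes H. C \<inter> B \<noteq> {}}"
  have numbers: "edge_numbers \<tau> = (card V, card B, m, n)"
    using single_edge_type(2)[OF H \<tau>] by (simp add: V_def B_def m_def n_def)
  have G: "ribbon_graph H" and fin: "finite (points H)"
    using H by (auto simp: coloured_ribbon_graph_def ribbon_graph_def)
  have partV: "partition_on (vertices H) (vertex_classes H)"
    and partB: "partition_on (boundaries H) (boundary_classes H)"
    and PV: "partition_on (points H) (vertices H)" and PB: "partition_on (points H) (boundaries H)"
    using H partition_on_boundary_circles[OF G]
    by (auto simp: coloured_ribbon_graph_def vertices_arc boundaries_arc)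
  have finV: "finite (vertices H)" "finite (vertex_classes H)"
    and finB: "finite (boundaries H)" "finite (boundary_classes H)"
    by (rule finite_elements[OF fin PV] finite_elements[OF fin PB]
        finite_elements[OF finite_elements[OF fin PV] partV]
        finite_elements[OF finite_elements[OF fin PB] partB])+
  have e: "e \<subseteq> points H" "e \<noteq> {}" using edge_properties[OF G] H(2) by auto
  have kV: "int (num_components (vertex_classes H) {e}) = int (card (vertex_classes H)) + 1 - int m"
    using num_components_single[OF PV partV finV(2) e] by (simp add: m_def V_def)
  have kB: "int (num_components (boundary_classes H) {e}) = int (card (boundary_classes H)) + 1 - int n"
    using num_components_single[OF PB partB finB(2) e] by (simp add: n_def B_def)
  \<comment> \<open>Cells away from \<open>e\<close> are both vertices and boundary components, so
    they cancel in the difference.\<close>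
  have "card (vertices H) = card V + card {u \<in> vertices H. \<not> meets u e}"
    using finV(1) by (subst card_Un_disjoint[symmetric]) (auto simp: V_def intro!: arg_cong[where f = card])
  moreover have "card (boundaries H) = card B + card {b \<in> boundaries H. \<not> meets b e}"
    using finB(1) by (subst card_Un_disjoint[symmetric]) (auto simp: B_def intro!: arg_cong[where f = card])
  ultimately have "int (card (boundaries H)) = int (card (vertices H)) + int (card B) - int (card V)"
    using remove_isolated_single(3)[OF H] by simp
  moreover have "num_boundaries H {e} = card (boundaries H)" "num_boundaries H {} = card (vertices H)"
    using H(2) by (simp_all add: num_boundaries_arc boundaries_arc vertices_arc)
  ultimately have b: "int (num_boundaries H {e}) = int (num_boundaries H {}) + int (card B) - int (card V)"
    by simp
  define k l c where "k = int (card (vertex_classes H))" and "l = int (card (boundary_classes H))"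
    and "c = int (num_boundaries H {})"
  define v w where "v = int (card V)" and "w = int (card B)"
  have "weight x s y t H {e} = x powi (int m - 1 - k) * s powi (3 + v - w - 2 * int m + (2 * k - c)) *
      y powi l * t powi (1 + w - v + (c - 2 * l))"
  proof -
    let ?k = "int (num_components (vertex_classes H) {e})" and ?b = "int (num_boundaries H {e})"
    have "weight x s y t H {e} = x powi (- ?k) * s powi (1 - ?b + 2 * ?k) * y powi l * t powi (1 + ?b - 2 * l)"
      by (simp add: weight_def Let_def H(2) num_components_empty l_def)
    moreover have "- ?k = int m - 1 - k" using kV by (simp add: k_def)
    moreover have "1 - ?b + 2 * ?k = 3 + v - w - 2 * int m + (2 * k - c)"
      using kV b by (simp add: k_def v_def w_def c_def)
    moreover have "1 + ?b - 2 * l = 1 + w - v + (c - 2 * l)" using b by (simp add: v_def w_def c_def)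
    ultimately show ?thesis by (simp only:)
  qed
  \<comment> \<open>The weight of \<open>{}\<close> is split off. The complement of
    \<open>{}\<close> is \<open>{e}\<close>, so its boundary component number is
    \<open>l + 1 - int n\<close>, not \<open>l\<close>.\<close>
  also have "\<dots> = x powi (int m - 1) * s powi (3 + v - w - 2 * int m) * y powi (int n - 1) *
      t powi (3 + w - v - 2 * int n) * (x powi (- k) * s powi (2 * k - c) * y powi (l + 1 - int n) *
      t powi (c - 2 * (l + 1 - int n)))"
    using power_int_add[of x "int m - 1" "- k"] power_int_add[of y "int n - 1" "l + 1 - int n"]
      power_int_add[of s "3 + v - w - 2 * int m" "2 * k - c"]
      power_int_add[of t "3 + w - v - 2 * int n" "c - 2 * (l + 1 - int n)"] nz
    by (simp add: algebra_simps)
  also have "x powi (- k) * s powi (2 * k - c) * y powi (l + 1 - int n) *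
      t powi (c - 2 * (l + 1 - int n)) = weight x s y t H {}"
    using kB by (simp add: weight_def Let_def H(2) num_components_empty k_def l_def c_def)
  also have "x powi (int m - 1) * s powi (3 + v - w - 2 * int m) * y powi (int n - 1) *
      t powi (3 + w - v - 2 * int n) = type_weight x s y t \<tau>"
  proof -
    have "card V = fst (edge_numbers \<tau>)" "card B = fst (snd (edge_numbers \<tau>))"
      "m = fst (snd (snd (edge_numbers \<tau>)))" "n = snd (snd (snd (edge_numbers \<tau>)))"
      using numbers by simp_all
    then show ?thesis unfolding v_def w_def by (cases \<tau>) simp_all
  qed
  finally show ?thesis .
qed

section \<open>Minors with a single edge\<close>

lemma minor_closedD:
  assumes "minor_closed \<G>" "G \<in> \<G>"
  shows "coloured_ribbon_graph G" "e \<in> edges G \<Longrightarrow> delete e G \<in> \<G>"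
    "e \<in> edges G \<Longrightarrow> contract e G \<in> \<G>"
  using assms by (auto simp: minor_closed_def)

lemma fold_contract:
  assumes "minor_closed \<G>" "G \<in> \<G>" "distinct es" "set es \<subseteq> edges G"
  shows "fold contract es G \<in> \<G> \<and> edges (fold contract es G) = edges G - set es"
  using assms(2-)
proof (induction es arbitrary: G)
  case (Cons f es)
  then have "contract f G \<in> \<G>" using minor_closedD(3)[OF assms(1)] by auto
  with Cons.IH[of "contract f G"] Cons.prems show ?case by auto
qed simp

lemma fold_delete:
  assumes "minor_closed \<G>" "G \<in> \<G>" "distinct es" "set es \<subseteq> edges G"
  shows "fold delete es G \<in> \<G> \<and> edges (fold delete es G) = edges G - set es"
  using assms(2-)
proof (induction es arbitrary: G)
  case (Cons f es)
  then have "delete f G \<in> \<G>" using minor_closedD(2)[OF assms(1)] by auto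
  with Cons.IH[of "delete f G"] Cons.prems show ?case by auto
qed simp

text \<open>Each contraction multiplies both weights by the same \<open>s * t\<close>, so their
  quotient survives.\<close>

lemma weight_fold_contract:
  assumes "minor_closed \<G>" "G \<in> \<G>" "distinct es" "set es \<subseteq> edges G - {e}"
    and nz: "x \<noteq> 0" "s \<noteq> 0" "y \<noteq> 0" "t \<noteq> 0"
  shows "weight x s y t G (edges G) / weight x s y t G (edges G - {e}) =
    weight x s y t (fold contract es G) (edges G - set es) /
    weight x s y t (fold contract es G) (edges G - set es - {e})"
  using assms(2-4)
proof (induction es arbitrary: G)
  case (Cons f es)
  let ?G = "contract f G"
  have f: "f \<in> edges G" "f \<noteq> e" using Cons.prems by auto
  note G = minor_closedD(1)[OF assms(1) Cons.prems(1)]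
  have "weight x s y t G (edges G) = s * t * weight x s y t ?G (edges ?G)"
    using weight_contract[OF G f(1), of "edges G - {f}"] f nz by (simp add: insert_absorb)
  moreover have "insert f (edges G - {f} - {e}) = edges G - {e}" using f by auto
  then have "weight x s y t G (edges G - {e}) = s * t * weight x s y t ?G (edges ?G - {e})"
    using weight_contract[OF G f(1), of "edges G - {f} - {e}" s t x y] f nz by auto
  ultimately have "weight x s y t G (edges G) / weight x s y t G (edges G - {e}) =
      weight x s y t ?G (edges ?G) / weight x s y t ?G (edges ?G - {e})"
    using nz by simp
  also have "\<dots> = weight x s y t (fold contract es ?G) (edges ?G - set es) /
    weight x s y t (fold contract es ?G) (edges ?G - set es - {e})"
    using Cons.prems minor_closedD(3)[OF assms(1) Cons.prems(1) f(1)] by (intro Cons.IH) auto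
  also have "edges ?G - set es = edges G - set (f # es)" by auto
  finally show ?case by simp
qed simp

lemma weight_fold_delete:
  assumes "minor_closed \<G>" "G \<in> \<G>" "distinct es" "set es \<subseteq> edges G" "A \<inter> set es = {}"
  shows "weight x s y t (fold delete es G) A = weight x s y t G A"
  using assms(2-)
proof (induction es arbitrary: G)
  case (Cons f es)
  have f: "f \<in> edges G" using Cons.prems by auto
  have "weight x s y t (fold delete es (delete f G)) A = weight x s y t (delete f G) A"
    using Cons.prems minor_closedD(2)[OF assms(1) Cons.prems(1) f] by (intro Cons.IH) auto
  also have "\<dots> = weight x s y t G A"
    using Cons.prems by (intro weight_delete minor_closedD(1)[OF assms(1)]) auto
  finally show ?case by simp
qed simp

text \<open>Contracting all other edges keeps the quotient at the top, from the complement of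
  \<open>e\<close> to the whole edge set; deleting them keeps the weights of \<open>{}\<close> and
  \<open>{e}\<close>. In both cases a one-edge graph of known type remains.\<close>

lemma has_type_weights:
  assumes "minor_closed \<G>" "G \<in> \<G>" "e \<in> edges G" "has_type G e i j"
    and nz: "x \<noteq> 0" "s \<noteq> 0" "y \<noteq> 0" "t \<noteq> 0"
  shows "weight x s y t G (edges G) = type_weight x s y t i * weight x s y t G (edges G - {e})"
    and "weight x s y t G {e} = type_weight x s y t j * weight x s y t G {}"
proof -
  obtain es where es: "distinct es" "set es = edges G - {e}"
      "is_single_edge i (remove_isolated (fold contract es G))"
    using assms(4) by (auto simp: has_type_def contracts_to_def)
  let ?H = "fold contract es G"
  have "edges G - set es = {e}" using es(2) assms(3) by auto
  then have H: "?H \<in> \<G>" "edges ?H = {e}" and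
    q: "weight x s y t G (edges G) / weight x s y t G (edges G - {e}) =
      weight x s y t ?H {e} / weight x s y t ?H {}"
    using fold_contract[OF assms(1,2) es(1)] weight_fold_contract[OF assms(1,2) es(1) _ nz, of e] es(2)
    by auto
  have "weight x s y t ?H {e} = type_weight x s y t i * weight x s y t ?H {}"
    by (rule weight_single[OF minor_closedD(1)[OF assms(1) H(1)] H(2) es(3) nz])
  with q show "weight x s y t G (edges G) = type_weight x s y t i * weight x s y t G (edges G - {e})"
    using weight_nonzero[OF nz, of G "edges G - {e}"] weight_nonzero[OF nz, of ?H "{}"]
    by (simp add: divide_simps)
next
  obtain es where es: "distinct es" "set es = edges G - {e}"
      "is_single_edge j (remove_isolated (fold delete es G))"
    using assms(4) by (auto simp: has_type_def deletes_to_def)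
  let ?H = "fold delete es G"
  have "edges G - set es = {e}" using es(2) assms(3) by auto
  then have H: "?H \<in> \<G>" "edges ?H = {e}"
    using fold_delete[OF assms(1,2) es(1)] es(2) by auto
  have "weight x s y t ?H {e} = weight x s y t G {e}" "weight x s y t ?H {} = weight x s y t G {}"
    using es(2) by (auto intro!: weight_fold_delete[OF assms(1,2) es(1)])
  then show "weight x s y t G {e} = type_weight x s y t j * weight x s y t G {}"
    using weight_single[OF minor_closedD(1)[OF assms(1) H(1)] H(2) es(3) nz] by simp
qed

text \<open>Any enumeration of the other edges reduces the graph to one edge, and a one-edge graph
  has one of the five types.\<close>

lemma has_type_exists:
  assumes "minor_closed \<G>" "G \<in> \<G>" "e \<in> edges G"
  obtains i j where "has_type G e i j"
proof -
  have "finite (edges G - {e})"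
    using minor_closedD(1)[OF assms(1,2)] finite_edges by (auto simp: coloured_ribbon_graph_def)
  from finite_distinct_list[OF this] obtain es where es: "set es = edges G - {e}" "distinct es" by auto
  then have e: "edges G - set es = {e}" "set es \<subseteq> edges G" using assms(3) by auto
  note c = fold_contract[OF assms(1,2) es(2) e(2), unfolded e]
    and d = fold_delete[OF assms(1,2) es(2) e(2), unfolded e]
  obtain i where "is_single_edge i (remove_isolated (fold contract es G))"
    using single_edge_type(1)[of "fold contract es G" e] c minor_closedD(1)[OF assms(1)] by auto
  moreover obtain j where "is_single_edge j (remove_isolated (fold delete es G))"
    using single_edge_type(1)[of "fold delete es G" e] d minor_closedD(1)[OF assms(1)] by auto
  ultimately have "has_type G e i j"
    unfolding has_type_def contracts_to_def deletes_to_def using es by blast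
  then show thesis by (rule that)
qed

section \<open>The state sum\<close>

lemma indet_nonzero: "indet i \<noteq> 0"
proof -
  have "Poly_Mapping.lookup (Poly_Mapping.single (Poly_Mapping.single i 1) 1) (Poly_Mapping.single i 1)
      = (1 :: int)" for i :: nat
    by simp
  then have "Poly_Mapping.single (Poly_Mapping.single i 1) 1 \<noteq> (0 :: (nat \<Rightarrow>\<^sub>0 nat) \<Rightarrow>\<^sub>0 int)"
    by (metis lookup_zero zero_neq_one)
  then show ?thesis by (simp add: indet_def Zero_fract_def eq_fract)
qed

lemmas indets = \<alpha>_def \<beta>_def sqrt_\<gamma>_def a_bs_def sqrt_a_bp_def a_olc_def sqrt_a_olh_def
  b_bs_def sqrt_b_bp_def b_olc_def sqrt_b_olh_def

lemma indets_nonzero [simp]: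
  "\<alpha> \<noteq> 0" "\<beta> \<noteq> 0" "sqrt_\<gamma> \<noteq> 0" "a_bs \<noteq> 0" "sqrt_a_bp \<noteq> 0" "a_olc \<noteq> 0" "sqrt_a_olh \<noteq> 0"
  "b_bs \<noteq> 0" "sqrt_b_bp \<noteq> 0" "b_olc \<noteq> 0" "sqrt_b_olh \<noteq> 0"
  by (simp_all add: indets indet_nonzero)

abbreviation weight_a :: "'p coloured_ribbon \<Rightarrow> 'p set set \<Rightarrow> rat_fun" where
  "weight_a \<equiv> weight a_bs sqrt_a_bp a_olc sqrt_a_olh"

abbreviation weight_b :: "'p coloured_ribbon \<Rightarrow> 'p set set \<Rightarrow> rat_fun" where
  "weight_b \<equiv> weight b_bs sqrt_b_bp b_olc sqrt_b_olh"

text \<open>The \<open>b\<close>-quotient measures the way from \<open>{}\<close> to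
  \<open>A\<close>, the \<open>a\<close>-quotient the way from \<open>A\<close> to the whole edge
  set. Graph-dependent factors of the weights cancel in both.\<close>

definition state :: "'p coloured_ribbon \<Rightarrow> 'p set set \<Rightarrow> rat_fun" where
  "state G A =
     \<alpha> ^ num_components (vertex_classes G) A *
     \<beta> ^ num_components (boundary_classes G) (edges G - A) *
     \<gamma> ^ num_boundaries G A *
     (weight_b G A / weight_b G {}) * (weight_a G (edges G) / weight_a G A)"

definition state_sum :: "'p coloured_ribbon \<Rightarrow> rat_fun" where
  "state_sum G = (\<Sum>A\<in>Pow (edges G). state G A)"

lemma weight_ab_nonzero [simp]: "weight_a G A \<noteq> 0" "weight_b G A \<noteq> 0"
  by (simp_all add: weight_nonzero)

text \<open>Of all the factors only the weight of the whole edge set changes, by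
  \<open>coeff_a i\<close>.\<close>

lemma state_delete:
  assumes "minor_closed \<G>" "G \<in> \<G>" "e \<in> edges G" "has_type G e i j" "A \<subseteq> edges G - {e}"
  shows "state G A = coeff_a i * state (delete e G) A"
proof -
  have "e \<notin> A" using assms(5) by auto
  note G = minor_closedD(1)[OF assms(1,2)] assms(3)
  note w = weight_delete[OF G]
  have "weight_a G (edges G) = coeff_a i * weight_a (delete e G) (edges G - {e})"
    using has_type_weights(1)[OF assms(1-4), of a_bs sqrt_a_bp a_olc sqrt_a_olh]
    by (simp add: coeff_type_weight w)
  then show ?thesis
    by (simp add: state_def w num_boundaries_delete num_components_delete[OF G] \<open>e \<notin> A\<close>)
qed

text \<open>The factor from \<open>weight_contract\<close> cancels in the \<open>a\<close>-quotient.
  In the \<open>b\<close>-quotient the base point moves from \<open>{e}\<close> back to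
  \<open>{}\<close>, which costs \<open>coeff_b j\<close>.\<close>

lemma state_contract:
  assumes "minor_closed \<G>" "G \<in> \<G>" "e \<in> edges G" "has_type G e i j" "A \<subseteq> edges G - {e}"
  shows "state G (insert e A) = coeff_b j * state (contract e G) A"
proof -
  have A: "e \<notin> A" "A \<subseteq> edges G" using assms(5) by auto
  note G = minor_closedD(1)[OF assms(1,2)] assms(3)
  note w = weight_contract[OF G]
  \<comment> \<open>Both sides equal the \<open>b\<close>-weight of \<open>{e}\<close> in
    \<open>G\<close>, computed from its type and by contraction.\<close>
  have b: "coeff_b j * weight_b G {} = sqrt_b_bp * sqrt_b_olh * weight_b (contract e G) {}"
    using has_type_weights(2)[OF assms(1-4), of b_bs sqrt_b_bp b_olc sqrt_b_olh]
      w[of "{}" sqrt_b_bp sqrt_b_olh b_bs b_olc]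
    by (simp add: coeff_type_weight)
  have "weight_a G (edges G) = sqrt_a_bp * sqrt_a_olh * weight_a (contract e G) (edges G - {e})"
    using w[of "edges G - {e}" sqrt_a_bp sqrt_a_olh a_bs a_olc] assms(3) by (simp add: insert_absorb)
  moreover have "edges G - insert e A = edges G - {e} - A" by auto
  moreover have "weight_b G (insert e A) / weight_b G {} =
      coeff_b j * (weight_b (contract e G) A / weight_b (contract e G) {})"
    using w[of A sqrt_b_bp sqrt_b_olh b_bs b_olc] A b by (simp add: field_simps)
  ultimately show ?thesis
    using A by (simp add: state_def w num_boundaries_contract num_components_contract[OF G])
qed

lemma state_sum_recursion:
  assumes "minor_closed \<G>" "G \<in> \<G>" "e \<in> edges G" "has_type G e i j"
  shows "state_sum G = coeff_a i * state_sum (delete e G) + coeff_b j * state_sum (contract e G)"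
proof -
  let ?E = "edges G - {e}"
  have "finite ?E"
    using minor_closedD(1)[OF assms(1,2)] finite_edges by (auto simp: coloured_ribbon_graph_def)
  have "Pow (edges G) = Pow ?E \<union> insert e ` Pow ?E"
    using assms(3) by (metis Pow_insert insert_Diff)
  moreover have "Pow ?E \<inter> insert e ` Pow ?E = {}" by auto
  moreover have "inj_on (insert e) (Pow ?E)"
    by (rule inj_onI) (metis Diff_iff PowD insert_ident singletonI subsetD)
  ultimately have "state_sum G = (\<Sum>A\<in>Pow ?E. state G A) + (\<Sum>A\<in>Pow ?E. state G (insert e A))"
    using \<open>finite ?E\<close> by (simp add: state_sum_def sum.union_disjoint sum.reindex)
  also have "(\<Sum>A\<in>Pow ?E. state G A) = coeff_a i * state_sum (delete e G)"
    using state_delete[OF assms] by (simp add: state_sum_def sum_distrib_left)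
  also have "(\<Sum>A\<in>Pow ?E. state G (insert e A)) = coeff_b j * state_sum (contract e G)"
    using state_contract[OF assms] by (simp add: state_sum_def sum_distrib_left)
  finally show ?thesis .
qed

lemma state_sum_edgeless:
  assumes "edges G = {}"
  shows "state_sum G =
    \<alpha> ^ card (vertex_classes G) * \<beta> ^ card (boundary_classes G) * \<gamma> ^ card (vertices G)"
  by (simp add: state_sum_def state_def assms num_components_empty num_boundaries_arc vertices_arc)

text \<open>Induction on the number of edges; the step receives an edge together with a type, so the
  recursion applies directly.\<close>

lemma minor_closed_induct [consumes 2]:
  assumes "minor_closed \<G>" "G \<in> \<G>"
    and base: "\<And>G. G \<in> \<G> \<Longrightarrow> edges G = {} \<Longrightarrow> P G"
    and step: "\<And>G e i j. G \<in> \<G> \<Longrightarrow> e \<in> edges G \<Longrightarrow> has_type G e i j \<Longrightarrow>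
      delete e G \<in> \<G> \<Longrightarrow> contract e G \<in> \<G> \<Longrightarrow> P (delete e G) \<Longrightarrow> P (contract e G) \<Longrightarrow> P G"
  shows "P G"
  using assms(2)
proof (induction "card (edges G)" arbitrary: G rule: less_induct)
  case less
  show ?case
  proof (cases "edges G = {}")
    case False
    then obtain e where e: "e \<in> edges G" by blast
    obtain i j where ij: "has_type G e i j" using has_type_exists[OF assms(1) less.prems e] .
    have "finite (edges G)"
      using minor_closedD(1)[OF assms(1) less.prems] finite_edges by (auto simp: coloured_ribbon_graph_def)
    then have card: "card (edges G - {e}) < card (edges G)" using e by (rule card_Diff1_less)
    note IH = less.hyps[of "delete e G"] less.hyps[of "contract e G"]
    with card minor_closedD(2,3)[OF assms(1) less.prems e] show ?thesis
      by (intro step[OF less.prems e ij]) simp_all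
  qed (use base less.prems in blast)
qed

lemma state_sum_unique:
  assumes "minor_closed \<G>" "deletion_contraction_invariant \<G> U" "G \<in> \<G>"
  shows "U G = state_sum G"
  using assms(1,3)
proof (induction rule: minor_closed_induct)
  case (1 G)
  then show ?case
    using assms(2) state_sum_edgeless[OF 1(2)] by (simp add: deletion_contraction_invariant_def)
next
  case (2 G e i j)
  then have "U G = coeff_a i * U (delete e G) + coeff_b j * U (contract e G)"
    using assms(2) by (auto simp: deletion_contraction_invariant_def)
  then show ?case using 2 state_sum_recursion[OF assms(1)] by simp
qed

section \<open>Membership in the coefficient ring\<close>

lemma int_adjoin_zero: "0 \<in> int_adjoin S"
  using int_adjoin.diff[OF int_adjoin.one int_adjoin.one, of S] by simp

lemma int_adjoin_add: "x \<in> int_adjoin S \<Longrightarrow> y \<in> int_adjoin S \<Longrightarrow> x + y \<in> int_adjoin S"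
  using int_adjoin.diff[OF _ int_adjoin.diff[OF int_adjoin_zero]] by fastforce

lemma int_adjoin_power: "x \<in> int_adjoin S \<Longrightarrow> x ^ n \<in> int_adjoin S"
  by (induction n) (auto intro: int_adjoin.one int_adjoin.mult)

lemma coeff_in_ring: "coeff_a \<tau> \<in> coeff_ring" "coeff_b \<tau> \<in> coeff_ring"
  unfolding coeff_ring_def
  by (cases \<tau>; auto intro: int_adjoin_power int_adjoin.mult int_adjoin.gen)+

text \<open>The definition of \<open>state\<close> involves quotients; membership is obtained from
  the recursion, which uses only ring operations.\<close>

lemma state_sum_in_ring:
  assumes "minor_closed \<G>" "G \<in> \<G>"
  shows "state_sum G \<in> coeff_ring"
  using assms
proof (induction rule: minor_closed_induct)
  case (1 G)
  then show ?case
    unfolding coeff_ring_def state_sum_edgeless[OF 1(2)]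
    by (intro int_adjoin_power int_adjoin.mult int_adjoin.gen) auto
next
  case (2 G e i j)
  then show ?case
    using coeff_in_ring unfolding state_sum_recursion[OF assms(1) 2(1-3)] coeff_ring_def
    by (intro int_adjoin_add int_adjoin.mult) auto
qed

section \<open>The state sum as a value of the Tutte polynomial\<close>

lemma half_power_int: "2 * q = of_int z \<Longrightarrow> half_power s q = s powi z"
  by (simp add: half_power_def)

text \<open>The two sums agree subset by subset: each term is a monomial, and the exponents are
  compared after doubling the half-integral parameters.\<close>

lemma state_sum_eq_tutte:
  assumes "coloured_ribbon_graph G"
  shows "state_sum G =
         \<alpha> ^ num_components (vertex_classes G) (edges G) *
         \<beta> ^ num_components (boundary_classes G) (edges G) *
         half_power sqrt_\<gamma> (of_nat (card (vertices G)) - rho G (edges G)) *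
         b_bs powi r1 G (edges G) *
         half_power sqrt_b_bp (r2 G (edges G)) *
         a_olc powi r3 G (edges G) *
         half_power sqrt_a_olh (r4 G (edges G)) *
         tutte_ps G
           (\<alpha> * \<gamma> * a_bs / b_bs)
           (sqrt_\<gamma> * sqrt_a_bp / sqrt_b_bp)
           (\<beta> * \<gamma> * b_olc / a_olc)
           (sqrt_\<gamma> * sqrt_b_olh / sqrt_a_olh)"
    (is "_ = ?pre * tutte_ps G ?w ?x ?y ?z")
proof -
  let ?E = "edges G"
  define v c where "v = int (card (vertices G))" and "c = int (card (vertex_classes G))"
  define k where "k A = int (num_components (vertex_classes G) A)" for A
  \<comment> \<open>Since \<open>l\<close> refers to the complement, \<open>l {}\<close> belongs to
    the full edge set and gives the exponent of \<beta> in front of the sum.\<close>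
  define l where "l A = int (num_components (boundary_classes G) (?E - A))" for A
  define b where "b A = int (num_boundaries G A)" for A
  define n where "n A = int (card A)" for A :: "'a set set"
  \<comment> \<open>\<open>R2\<close> and \<open>R4\<close> are twice \<open>r2\<close> and
    \<open>r4\<close>, hence the integer exponents of the square roots.\<close>
  define R2 where "R2 A = n A + v - b A - 2 * (c - k A)" for A
  define R4 where "R4 A = n A - v + b A - 2 * (l A - l {})" for A
  have r1: "r1 G A = c - k A" for A by (simp add: r1_def class_rank_def c_def k_def)
  have r3: "r3 G A = l A - l {}" for A by (simp add: r3_def class_rank_def l_def)
  have rho: "2 * rho G A = of_int (n A + v - b A)" for A
    by (simp add: rho_def n_def v_def b_def)
  have r2: "2 * r2 G A = of_int (R2 A)" for A
    using rho[of A] r1[of A] by (simp add: r2_def r1_def R2_def algebra_simps)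
  have r4: "2 * r4 G A = of_int (R4 A)" for A
  proof -
    have "2 * r4 G A = 2 * of_int (n A) - 2 * of_int (r3 G A) - 2 * rho G A"
      by (simp add: r4_def r3_def n_def algebra_simps)
    then show ?thesis unfolding rho r3 by (simp add: R4_def algebra_simps)
  qed
  have r2': "2 * (r2 G ?E - r2 G A) = of_int (R2 ?E - R2 A)" for A
    using r2[of A] r2[of ?E] by (simp add: algebra_simps)
  have v: "2 * (of_nat (card (vertices G)) - rho G ?E) = of_int (v - n ?E + b ?E)"
    using rho[of ?E] by (simp add: v_def algebra_simps)
  have k0: "k {} = c" by (simp add: k_def c_def num_components_empty)
  have b0: "b {} = v" by (simp add: b_def v_def num_boundaries_arc vertices_arc)
  have weight: "weight x s y t G A =
      x powi (- k A) * s powi (n A - b A + 2 * k A) * y powi l A * t powi (n A + b A - 2 * l A)"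
    for x s y t :: rat_fun and A
    by (simp add: weight_def Let_def k_def l_def b_def n_def)
  have n0: "n {} = 0" by (simp add: n_def)
  have wb: "weight_b G A / weight_b G {} =
      b_bs powi (c - k A) * sqrt_b_bp powi R2 A * b_olc powi (l A - l {}) * sqrt_b_olh powi R4 A" for A
  proof -
    have "weight_b G A = b_bs powi (c - k A) * sqrt_b_bp powi R2 A * b_olc powi (l A - l {}) *
        sqrt_b_olh powi R4 A * weight_b G {}"
      using power_int_add[of b_bs "c - k A" "- c"] power_int_add[of sqrt_b_bp "R2 A" "- v + 2 * c"]
        power_int_add[of b_olc "l A - l {}" "l {}"] power_int_add[of sqrt_b_olh "R4 A" "v - 2 * l {}"]
      unfolding weight k0 b0 n0 by (simp add: R2_def R4_def algebra_simps)
    then show ?thesis by simp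
  qed
  have wa: "weight_a G ?E / weight_a G A =
      a_bs powi (k A - k ?E) * sqrt_a_bp powi (R2 ?E - R2 A) * a_olc powi (l ?E - l A) *
      sqrt_a_olh powi (R4 ?E - R4 A)" for A
  proof -
    have "weight_a G ?E = a_bs powi (k A - k ?E) * sqrt_a_bp powi (R2 ?E - R2 A) *
        a_olc powi (l ?E - l A) * sqrt_a_olh powi (R4 ?E - R4 A) * weight_a G A"
      using power_int_add[of a_bs "k A - k ?E" "- k A"]
        power_int_add[of sqrt_a_bp "R2 ?E - R2 A" "n A - b A + 2 * k A"]
        power_int_add[of a_olc "l ?E - l A" "l A"]
        power_int_add[of sqrt_a_olh "R4 ?E - R4 A" "n A + b A - 2 * l A"]
      unfolding weight by (simp add: R2_def R4_def algebra_simps)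
    then show ?thesis by simp
  qed
  show ?thesis
    unfolding tutte_ps_def state_sum_def sum_distrib_left
  proof (rule sum.cong)
    fix A assume "A \<in> Pow ?E"
    define d1 d2 d3 d4 where "d1 = k A - k ?E" and "d2 = R2 ?E - R2 A" and "d3 = l A - l {}"
      and "d4 = R4 A"
    have \<gamma>: "\<gamma> powi i = sqrt_\<gamma> powi (2 * i)" for i
      by (simp add: \<gamma>_def power_int_mult)
    \<comment> \<open>The powers of \<open>sqrt_\<gamma>\<close> from the prefactor and the four
      arguments of the polynomial add up to that in \<open>\<gamma> powi b A\<close>.\<close>
    have sum_\<gamma>: "v - n ?E + b ?E + 2 * d1 + d2 + 2 * d3 + d4 = 2 * b A"
      by (simp add: d1_def d2_def d3_def d4_def R2_def R4_def)
    have pre: "?pre = \<alpha> powi k ?E * \<beta> powi l {} * sqrt_\<gamma> powi (v - n ?E + b ?E) * b_bs powi (c - k ?E) *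
        sqrt_b_bp powi R2 ?E * a_olc powi (l ?E - l {}) * sqrt_a_olh powi R4 ?E"
      by (simp add: r1 r3 half_power_int[OF v] half_power_int[OF r2] half_power_int[OF r4])
         (simp add: k_def l_def)
    have "state G A = \<alpha> powi k A * \<beta> powi l A * \<gamma> powi b A *
        (weight_b G A / weight_b G {}) * (weight_a G ?E / weight_a G A)"
      by (simp add: state_def k_def l_def b_def)
    moreover have "\<alpha> powi k A = \<alpha> powi k ?E * \<alpha> powi d1"
      by (simp add: d1_def flip: power_int_add)
    moreover have "\<beta> powi l A = \<beta> powi l {} * \<beta> powi d3"
      by (simp add: d3_def flip: power_int_add)
    moreover have "\<gamma> powi b A = sqrt_\<gamma> powi (v - n ?E + b ?E) * \<gamma> powi d1 * sqrt_\<gamma> powi d2 *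
        \<gamma> powi d3 * sqrt_\<gamma> powi d4"
      unfolding \<gamma> sum_\<gamma>[symmetric] by (simp add: power_int_add)
    moreover have "b_bs powi (c - k A) = b_bs powi (c - k ?E) / b_bs powi d1"
      by (simp add: d1_def flip: power_int_diff)
    moreover have "sqrt_b_bp powi R2 A = sqrt_b_bp powi R2 ?E / sqrt_b_bp powi d2"
      by (simp add: d2_def flip: power_int_diff)
    moreover have "a_olc powi (l ?E - l A) = a_olc powi (l ?E - l {}) / a_olc powi d3"
      by (simp add: d3_def flip: power_int_diff)
    moreover have "sqrt_a_olh powi (R4 ?E - R4 A) = sqrt_a_olh powi R4 ?E / sqrt_a_olh powi d4"
      by (simp add: d4_def flip: power_int_diff)
    moreover have "r1 G ?E - r1 G A = d1" "r3 G A = d3" by (simp_all add: r1 r3 d1_def d3_def)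
    ultimately show "state G A = ?pre * (?w powi (r1 G ?E - r1 G A) *
        half_power ?x (r2 G ?E - r2 G A) * ?y powi r3 G A * half_power ?z (r4 G A))"
      unfolding pre
      unfolding half_power_int[OF r2'] half_power_int[OF r4] wa wb
      by (simp add: power_int_mult_distrib power_int_divide_distrib mult_ac flip: d1_def d2_def d3_def d4_def)
  qed simp
qed

theorem theorem3p7:
  fixes \<G> :: "'p coloured_ribbon set"
  assumes "minor_closed \<G>"
  shows "(\<exists>!U. U \<in> \<G> \<rightarrow>\<^sub>E coeff_ring \<and> deletion_contraction_invariant \<G> U) \<and>
    (\<forall>U. U \<in> \<G> \<rightarrow>\<^sub>E coeff_ring \<and> deletion_contraction_invariant \<G> U \<longrightarrow>
      (\<forall>G\<in>\<G>. U G =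
         \<alpha> ^ num_components (vertex_classes G) (edges G) *
         \<beta> ^ num_components (boundary_classes G) (edges G) *
         half_power sqrt_\<gamma> (of_nat (card (vertices G)) - rho G (edges G)) *
         b_bs powi r1 G (edges G) *
         half_power sqrt_b_bp (r2 G (edges G)) *
         a_olc powi r3 G (edges G) *
         half_power sqrt_a_olh (r4 G (edges G)) *
         tutte_ps G
           (\<alpha> * \<gamma> * a_bs / b_bs)
           (sqrt_\<gamma> * sqrt_a_bp / sqrt_b_bp)
           (\<beta> * \<gamma> * b_olc / a_olc)
           (sqrt_\<gamma> * sqrt_b_olh / sqrt_a_olh)))"
proof (intro conjI allI impI ballI)
  \<comment> \<open>Restriction fixes the value outside the class, so that uniqueness holds for
    functions on the whole type.\<close>
  let ?U = "restrict state_sum \<G>"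
  show "\<exists>!U. U \<in> \<G> \<rightarrow>\<^sub>E coeff_ring \<and> deletion_contraction_invariant \<G> U"
  proof (rule ex1I[of _ ?U])
    show "?U \<in> \<G> \<rightarrow>\<^sub>E coeff_ring \<and> deletion_contraction_invariant \<G> ?U"
      using state_sum_in_ring[OF assms] state_sum_recursion[OF assms] state_sum_edgeless
        minor_closedD[OF assms]
      by (auto simp: deletion_contraction_invariant_def)
  next
    fix U assume U: "U \<in> \<G> \<rightarrow>\<^sub>E coeff_ring \<and> deletion_contraction_invariant \<G> U"
    show "U = ?U"
    proof
      fix G
      show "U G = ?U G"
        using state_sum_unique[OF assms conjunct2[OF U]] PiE_arb[OF conjunct1[OF U]]
        by (cases "G \<in> \<G>") simp_all
    qed
  qed
next
  fix U G
  assume "U \<in> \<G> \<rightarrow>\<^sub>E coeff_ring \<and> deletion_contraction_invariant \<G> U" "G \<in> \<G>"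
  then have "U G = state_sum G" using state_sum_unique[OF assms] by blast
  also note state_sum_eq_tutte[OF minor_closedD(1)[OF assms \<open>G \<in> \<G>\<close>]]
  finally show "U G = \<alpha> ^ num_components (vertex_classes G) (edges G) *
         \<beta> ^ num_components (boundary_classes G) (edges G) *
         half_power sqrt_\<gamma> (of_nat (card (vertices G)) - rho G (edges G)) *
         b_bs powi r1 G (edges G) *
         half_power sqrt_b_bp (r2 G (edges G)) *
         a_olc powi r3 G (edges G) *
         half_power sqrt_a_olh (r4 G (edges G)) *
         tutte_ps G
           (\<alpha> * \<gamma> * a_bs / b_bs)
           (sqrt_\<gamma> * sqrt_a_bp / sqrt_b_bp)
           (\<beta> * \<gamma> * b_olc / a_olc)
           (sqrt_\<gamma> * sqrt_b_olh / sqrt_a_olh)" .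
qed

end
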